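(* Let $H$ be an infinite-dimensional complex separable Hilbert space, let $1\le p<\infty$, and let $A,B\in\mathcal B(H)$. Assume that $R(A)$ is closed and that $N(A)\subseteq N(B)$. Then the following statements are equivalent: (1) $A-B\in\mathcal K_p(H)$. (2) There exists $X\in\mathcal B(H)$ with $X-I\in\mathcal K_p(H)$ such that $B=XA$.
   Context: $\mathcal B(H)$ denotes the bounded linear operators on $H$; $N(\cdot)$ and $R(\cdot)$ denote null space and range. $\mathcal K_p(H)$ is the Schatten $p$-class: compact operators $S$ whose singular values $s_n(S)$ (eigenvalues of $(S^*S)^{1/2}$ with multiplicity) satisfy $\sum_n s_n(S)^p<\infty$. *)

theory Defs
  imports "HOL-Analysis.Analysis"
begin

class complex_vector = real_vector +
  fixes scaleC :: "complex \<Rightarrow> 'a \<Rightarrow> 'a" (infixr "*\<^sub>C" 75)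
  assumes scaleC_add_right: "a *\<^sub>C (x + y) = a *\<^sub>C x + a *\<^sub>C y"
    and scaleC_add_left: "(a + b) *\<^sub>C x = a *\<^sub>C x + b *\<^sub>C x"
    and scaleC_scaleC: "a *\<^sub>C (b *\<^sub>C x) = (a * b) *\<^sub>C x"
    and scaleC_one: "1 *\<^sub>C x = x"
    and scaleR_scaleC: "r *\<^sub>R x = complex_of_real r *\<^sub>C x"

global_interpretation complex_vector: vector_space "scaleC :: complex \<Rightarrow> 'a \<Rightarrow> 'a::complex_vector"
  by unfold_locales
    (simp_all add: scaleC_add_right scaleC_add_left scaleC_scaleC scaleC_one)

text \<open>
  The inner product is linear in the first argument. The real inner product inherited from
  \<^class>\<open>real_inner\<close> is the real part of the complex one; in particular the norm is the one
  induced by the complex inner product, which is therefore positive definite.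
\<close>

class complex_inner = complex_vector + real_inner +
  fixes cinner :: "'a \<Rightarrow> 'a \<Rightarrow> complex"
  assumes cinner_add_left: "cinner (x + y) z = cinner x z + cinner y z"
    and cinner_scaleC_left: "cinner (a *\<^sub>C x) y = a * cinner x y"
    and cinner_commute: "cinner x y = cnj (cinner y x)"
    and inner_eq_Re_cinner: "inner x y = Re (cinner x y)"

class complex_hilbert_space = complex_inner + complete_space

definition bounded_clinear :: "('a::complex_hilbert_space \<Rightarrow> 'a) \<Rightarrow> bool" where
  "bounded_clinear T \<longleftrightarrow> bounded_linear T \<and> (\<forall>c x. T (c *\<^sub>C x) = c *\<^sub>C T x)"

definition null_space :: "('a \<Rightarrow> 'a::zero) \<Rightarrow> 'a set" where
  "null_space T = {x. T x = 0}"

definition adjoint_op :: "('a::complex_hilbert_space \<Rightarrow> 'a) \<Rightarrow> 'a \<Rightarrow> 'a" where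
  "adjoint_op T = (THE U. bounded_clinear U \<and> (\<forall>x y. cinner (T x) y = cinner x (U y)))"

definition positive_op :: "('a::complex_hilbert_space \<Rightarrow> 'a) \<Rightarrow> bool" where
  "positive_op T \<longleftrightarrow> bounded_clinear T \<and> (\<forall>x. cinner (T x) x \<in> \<real>\<^sub>\<ge>\<^sub>0)"

definition sqrt_op :: "('a::complex_hilbert_space \<Rightarrow> 'a) \<Rightarrow> 'a \<Rightarrow> 'a" where
  "sqrt_op T = (THE P. positive_op P \<and> P \<circ> P = T)"

definition abs_op :: "('a::complex_hilbert_space \<Rightarrow> 'a) \<Rightarrow> 'a \<Rightarrow> 'a" where
  "abs_op S = sqrt_op (adjoint_op S \<circ> S)"

definition compact_op :: "('a::complex_hilbert_space \<Rightarrow> 'a) \<Rightarrow> bool" where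
  "compact_op S \<longleftrightarrow> bounded_clinear S \<and> compact (closure (S ` cball 0 1))"

definition eigenspace :: "('a::complex_hilbert_space \<Rightarrow> 'a) \<Rightarrow> complex \<Rightarrow> 'a set" where
  "eigenspace T c = {x. T x = c *\<^sub>C x}"

text \<open>
  For compact \<open>S\<close>, this says that \<open>s\<close> is the decreasing enumeration of the nonzero eigenvalues of
  \<open>(S\<^sup>*S)\<^sup>1\<^sup>/\<^sup>2\<close>, each repeated according to its multiplicity, and
  padded with zeros if there are only finitely many. These conditions determine \<open>s\<close> uniquely.
  For compact \<open>S\<close> the eigenspaces in question are finite-dimensional, so the convention that
  the dimension of an infinite-dimensional space is \<open>0\<close> plays no role.
\<close>

definition singular_values :: "('a::complex_hilbert_space \<Rightarrow> 'a) \<Rightarrow> (nat \<Rightarrow> real) \<Rightarrow> bool" where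
  "singular_values S s \<longleftrightarrow> decseq s \<and> (\<forall>n. 0 \<le> s n) \<and>
     (\<forall>t>0. finite {n. s n = t} \<and>
            card {n. s n = t} = complex_vector.dim (eigenspace (abs_op S) (complex_of_real t)))"

definition schatten_class :: "real \<Rightarrow> ('a::complex_hilbert_space \<Rightarrow> 'a) set" where
  "schatten_class p =
     {S. compact_op S \<and> (\<exists>s. singular_values S s \<and> summable (\<lambda>n. s n powr p))}"

end

theory Submission imports Defs begin

text \<open>
  Each of the two differences \<open>A - B\<close> and \<open>X - I\<close> is the other one composed on the right with a
  bounded operator. If \<open>B = X A\<close>, then \<open>A - B = (X - I) (- A)\<close>. Conversely, an operator
  \<open>A\<close> with closed range has a bounded inner inverse \<open>G\<close>, that is \<open>A G A = A\<close>
  (\<open>bounded_inner_inverse_exists\<close>). Put \<open>X = I + (B - A) G\<close>. Every \<open>x - G A x\<close> lies in the null space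
  of \<open>A\<close>, hence in that of \<open>B\<close>, so \<open>X A = A + B G A - A G A = B\<close>, while
  \<open>X - I = (A - B) (- G)\<close>. The theorem therefore follows once the Schatten class is known to be
  stable under right multiplication by bounded operators (\<open>schatten_class_comp\<close>).

  For this stability, a compact \<open>S\<close> is given a singular system: an orthonormal sequence of
  eigenvectors \<open>e n\<close> of \<open>S\<^sup>*S\<close>, found by maximizing \<open>norm (S v)\<close> successively on orthogonal complements
  (\<open>singular_system_exists\<close>). It yields an explicit positive square root of
  \<open>S\<^sup>*S\<close>, shows that this root is the only one, and identifies its eigenspaces, so that
  \<open>norm (S (e n))\<close> is an enumeration of the singular values. Such an enumeration is unique
  (\<open>singular_values_unique\<close>). The maximality built into the sequence gives the comparison
  \<open>s\<^sub>n(S T) \<le> K s\<^sub>n(S)\<close>, with \<open>K\<close> a bound for \<open>T\<close>, by counting dimensions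
  (\<open>singular_system_comp_le\<close>).

  The inner inverse comes from the uniform boundedness principle: it bounds the adjoint from below
  on the range of \<open>A\<close>, and this passes to a lower bound for \<open>A\<close> on the orthogonal complement of
  its null space.
\<close>

section \<open>Complex inner products\<close>

lemma cinner_add_right: "cinner x (y + z) = cinner x y + cinner x (z::'a::complex_inner)"
  by (metis cinner_add_left cinner_commute complex_cnj_add)

lemma cinner_scaleC_right: "cinner x (a *\<^sub>C y) = cnj a * cinner x (y::'a::complex_inner)"
  by (metis cinner_scaleC_left cinner_commute complex_cnj_mult)

lemma cinner_zero [simp]: "cinner 0 x = 0" "cinner x 0 = 0" for x :: "'a::complex_inner"
  using cinner_add_left[of 0 0 x] cinner_add_right[of x 0 0] by auto

lemma cinner_minus [simp]: "cinner (- x) y = - cinner x y" "cinner x (- y) = - cinner x y"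
  for x :: "'a::complex_inner"
  using cinner_add_left[of x "- x" y] cinner_add_right[of x y "- y"]
  by (simp_all add: eq_neg_iff_add_eq_0 add.commute)

lemma cinner_diff: "cinner (x - y) z = cinner x z - cinner y z"
  "cinner x (y - z) = cinner x y - cinner x z" for x :: "'a::complex_inner"
  using cinner_add_left[of x "- y" z] cinner_add_right[of x y "- z"] by simp_all

lemma cinner_sum_left: "cinner (\<Sum>i\<in>I. f i) y = (\<Sum>i\<in>I. cinner (f i) y)"
  for y :: "'a::complex_inner"
  by (induction I rule: infinite_finite_induct) (auto simp: cinner_add_left)

lemma cinner_sum_right: "cinner y (\<Sum>i\<in>I. f i) = (\<Sum>i\<in>I. cinner y (f i))"
  for y :: "'a::complex_inner"
  by (induction I rule: infinite_finite_induct) (auto simp: cinner_add_right)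

lemma cinner_self: "cinner x x = complex_of_real ((norm x)\<^sup>2)" for x :: "'a::complex_inner"
proof (rule complex_eqI)
  show "Re (cinner x x) = Re (complex_of_real ((norm x)\<^sup>2))"
    by (simp add: inner_eq_Re_cinner[symmetric] power2_norm_eq_inner)
  show "Im (cinner x x) = Im (complex_of_real ((norm x)\<^sup>2))"
    using arg_cong[OF cinner_commute[of x x], of Im] by simp
qed

lemma cinner_eq_0_commute: "cinner x y = 0 \<longleftrightarrow> cinner y x = 0" for x :: "'a::complex_inner"
  by (metis cinner_commute complex_cnj_zero_iff)

text \<open>
  The real inner product with \<open>y\<close> and with \<open>\<i> y\<close> recovers the complex one. So facts about the
  real structure, such as orthogonality and Riesz representation, transfer to the complex structure
  as soon as the sets or maps involved respect multiplication by \<open>\<i>\<close>.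
\<close>

lemma cinner_eq_Complex_inner: "cinner x y = Complex (inner x y) (inner x (\<i> *\<^sub>C y))"
  for x :: "'a::complex_inner"
  by (simp add: complex_eq_iff inner_eq_Re_cinner cinner_scaleC_right)

lemma norm_scaleC: "norm (c *\<^sub>C x) = cmod c * norm x" for x :: "'a::complex_inner"
proof -
  have "complex_of_real ((norm (c *\<^sub>C x))\<^sup>2) = c * cnj c * cinner x x"
    by (simp only: cinner_self[symmetric] cinner_scaleC_left cinner_scaleC_right) (simp add: ac_simps)
  also have "\<dots> = complex_of_real ((cmod c * norm x)\<^sup>2)"
    by (simp add: cinner_self complex_norm_square[symmetric] power_mult_distrib)
  finally have "(norm (c *\<^sub>C x))\<^sup>2 = (cmod c * norm x)\<^sup>2"
    using of_real_eq_iff by blast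
  then show ?thesis by (simp add: power2_eq_iff_nonneg)
qed

lemma cmod_cinner_le: "cmod (cinner x y) \<le> norm x * norm y" for x :: "'a::complex_inner"
proof (cases "cinner x y = 0")
  case False
  define z where "z = cinner x y"
  have "(cmod z)\<^sup>2 = Re (cinner (cnj z *\<^sub>C x) y)"
    by (simp add: cinner_scaleC_left z_def[symmetric] cmod_power2) (simp add: power2_eq_square)
  also have "\<dots> \<le> norm (cnj z *\<^sub>C x) * norm y"
    by (metis inner_eq_Re_cinner norm_cauchy_schwarz)
  finally have "cmod z * cmod z \<le> cmod z * (norm x * norm y)"
    by (simp add: norm_scaleC power2_eq_square)
  then show ?thesis using False by (simp add: z_def)
qed simp

lemma bounded_linear_cinner_left: "bounded_linear (\<lambda>x. cinner x y)" for y :: "'a::complex_inner"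
  by (rule bounded_linear_intro[where K = "norm y"])
    (auto simp: cinner_add_left cinner_scaleC_left scaleR_scaleC cmod_cinner_le scaleR_conv_of_real)

lemmas tendsto_cinner_left = bounded_linear.tendsto[OF bounded_linear_cinner_left]

lemma norm_add_orthogonal:
  "cinner x y = 0 \<Longrightarrow> (norm (x + y))\<^sup>2 = (norm x)\<^sup>2 + (norm y)\<^sup>2" for x :: "'a::complex_inner"
  by (simp add: power2_norm_eq_inner inner_add inner_commute[of y x] inner_eq_Re_cinner[of x y])

lemma norm_diff_scaleR:
  "(norm (x - r *\<^sub>R y))\<^sup>2 = (norm x)\<^sup>2 - 2 * r * inner x y + r\<^sup>2 * (norm y)\<^sup>2"
  for x :: "'a::real_inner"
  unfolding power2_norm_eq_inner
  by (simp add: inner_diff inner_commute[of y x] algebra_simps power2_eq_square)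

lemma parallelogram: "(norm (x - y))\<^sup>2 = 2 * (norm x)\<^sup>2 + 2 * (norm y)\<^sup>2 - (norm (x + y))\<^sup>2"
  for x :: "'a::real_inner"
  by (simp add: power2_norm_eq_inner inner_diff inner_add inner_commute[of y x])

section \<open>Bounded operators\<close>

lemma bounded_clinearI:
  assumes "\<And>x y. T (x + y) = T x + T y" "\<And>c x. T (c *\<^sub>C x) = c *\<^sub>C T x"
    "\<And>x. norm (T x) \<le> norm x * K"
  shows "bounded_clinear T"
  unfolding bounded_clinear_def
  using assms by (auto intro!: bounded_linear_intro[where K = K] simp: scaleR_scaleC)

lemma bounded_clinearD:
  assumes "bounded_clinear T"
  shows "bounded_linear T" "T (x + y) = T x + T y" "T (x - y) = T x - T y" "T (- x) = - T x"
    "T 0 = 0" "T (c *\<^sub>C x) = c *\<^sub>C T x" "T (r *\<^sub>R x) = r *\<^sub>R T x"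
    "T (sum f I) = (\<Sum>i\<in>I. T (f i))"
proof -
  show bl: "bounded_linear T" using assms by (simp add: bounded_clinear_def)
  then interpret bounded_linear T .
  show "T (x + y) = T x + T y" "T (x - y) = T x - T y" "T (- x) = - T x" "T 0 = 0"
    "T (r *\<^sub>R x) = r *\<^sub>R T x" "T (sum f I) = (\<Sum>i\<in>I. T (f i))"
    by (simp_all add: add diff neg zero scale sum)
  show "T (c *\<^sub>C x) = c *\<^sub>C T x" using assms by (simp add: bounded_clinear_def)
qed

lemma bounded_clinear_bound:
  assumes "bounded_clinear T"
  obtains K where "K > 0" "\<And>x. norm (T x) \<le> K * norm x"
  using bounded_linear.pos_bounded[OF bounded_clinearD(1)[OF assms]] by (metis mult.commute)

lemma bounded_clinear_comp:
  assumes "bounded_clinear S" "bounded_clinear T" shows "bounded_clinear (S \<circ> T)"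
  using assms bounded_linear_compose[of S T] by (auto simp: bounded_clinear_def o_def)

lemma bounded_clinear_add:
  assumes "bounded_clinear S" "bounded_clinear T" shows "bounded_clinear (\<lambda>x. S x + T x)"
  using assms bounded_linear_add[of S T] by (auto simp: bounded_clinear_def scaleC_add_right)

lemma bounded_clinear_minus:
  assumes "bounded_clinear S" shows "bounded_clinear (\<lambda>x. - S x)"
  using assms bounded_linear_minus[of S]
  by (auto simp: bounded_clinear_def complex_vector.scale_minus_right)

lemma bounded_clinear_diff:
  assumes "bounded_clinear S" "bounded_clinear T" shows "bounded_clinear (\<lambda>x. S x - T x)"
  using bounded_clinear_add[OF assms(1) bounded_clinear_minus[OF assms(2)]] by simp

lemma bounded_clinear_ident: "bounded_clinear (\<lambda>x. x)"
  by (simp add: bounded_clinear_def)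

section \<open>Orthogonal projection, Riesz representation and adjoints\<close>

text \<open>
  The points of \<open>M\<close> whose squared distance to \<open>x\<close> exceeds the infimum by at most \<open>1/(n+1)\<close> form
  nested closed sets. By the parallelogram law their diameters tend to zero, so completeness yields
  a nearest point.
\<close>

lemma orthogonal_projection_exists:
  fixes M :: "'a::{real_inner, complete_space} set"
  assumes "subspace M" "closed M"
  obtains p where "p \<in> M" "\<And>v. v \<in> M \<Longrightarrow> inner (x - p) v = 0"
proof -
  define d where "d = (INF p\<in>M. (norm (x - p))\<^sup>2)"
  define C where "C n = {p \<in> M. (norm (x - p))\<^sup>2 \<le> d + 1 / real (Suc n)}" for n
  have M0: "0 \<in> M" using assms(1) by (rule subspace_0)
  have bdd: "bdd_below ((\<lambda>p. (norm (x - p))\<^sup>2) ` M)" by (rule bdd_belowI[of _ 0]) auto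
  have dle: "d \<le> (norm (x - p))\<^sup>2" if "p \<in> M" for p
    unfolding d_def using bdd that by (rule cINF_lower)
  have small: "(dist p q)\<^sup>2 \<le> 4 / real (Suc n)" if "p \<in> C n" "q \<in> C n" for p q n
  proof -
    \<comment> \<open>The midpoint of \<open>p\<close> and \<open>q\<close> is again in \<open>M\<close>, hence no closer to \<open>x\<close> than \<open>d\<close> allows.\<close>
    have mid: "(1/2) *\<^sub>R (p + q) \<in> M"
      using that assms(1) by (auto simp: C_def intro!: subspace_scale subspace_add)
    have "(x - q) + (x - p) = 2 *\<^sub>R (x - (1/2) *\<^sub>R (p + q))"
      by (simp add: algebra_simps scaleR_2)
    then have "(norm ((x - q) + (x - p)))\<^sup>2 = 4 * (norm (x - (1/2) *\<^sub>R (p + q)))\<^sup>2"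
      by (simp add: power_mult_distrib)
    then have "4 * d \<le> (norm ((x - q) + (x - p)))\<^sup>2" using dle[OF mid] by simp
    moreover have "(norm (p - q))\<^sup>2
        = 2 * (norm (x - q))\<^sup>2 + 2 * (norm (x - p))\<^sup>2 - (norm ((x - q) + (x - p)))\<^sup>2"
      using parallelogram[of "x - q" "x - p"] by simp
    moreover have "(norm (x - p))\<^sup>2 \<le> d + 1 / real (Suc n)" "(norm (x - q))\<^sup>2 \<le> d + 1 / real (Suc n)"
      using that by (auto simp: C_def)
    ultimately show ?thesis by (simp add: dist_norm)
  qed
  obtain p where p: "\<And>n. p \<in> C n"
  proof (rule decreasing_closed_nest[of C])
    show "closed (C n)" for n
    proof -
      have "C n = M \<inter> {p. (norm (x - p))\<^sup>2 \<le> d + 1 / real (Suc n)}" by (auto simp: C_def)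
      then show ?thesis
        using assms(2) by (auto intro!: closed_Int closed_Collect_le continuous_intros)
    qed
    show "C n \<noteq> {}" for n
    proof -
      have "d < d + 1 / real (Suc n)" by simp
      then obtain p where "p \<in> M" "(norm (x - p))\<^sup>2 < d + 1 / real (Suc n)"
        unfolding d_def using cINF_less_iff[OF _ bdd] M0 by blast
      then show ?thesis by (auto simp: C_def intro: less_imp_le)
    qed
    show "C n \<subseteq> C m" if "m \<le> n" for m n
    proof -
      have "1 / real (Suc n) \<le> 1 / real (Suc m)" using that by (simp add: frac_le)
      then show ?thesis by (auto simp: C_def)
    qed
    show "\<exists>n. \<forall>x\<in>C n. \<forall>y\<in>C n. dist x y < \<epsilon>" if "\<epsilon> > 0" for \<epsilon>
    proof -
      have "0 < \<epsilon>\<^sup>2 / 4" using that by simp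
      then obtain n where "inverse (real (Suc n)) < \<epsilon>\<^sup>2 / 4"
        using reals_Archimedean by blast
      then have n: "4 / real (Suc n) < \<epsilon>\<^sup>2" by (simp add: inverse_eq_divide)
      have "dist u v < \<epsilon>" if "u \<in> C n" "v \<in> C n" for u v
        using small[OF that] n \<open>\<epsilon> > 0\<close> by (intro power2_less_imp_less[of _ \<epsilon>]) linarith+
      then show ?thesis by blast
    qed
  qed auto
  have pM: "p \<in> M" using p by (auto simp: C_def)
  have pd: "(norm (x - p))\<^sup>2 \<le> d"
  proof (rule field_le_epsilon)
    fix e :: real assume "e > 0"
    then obtain n where "inverse (real (Suc n)) < e" using reals_Archimedean by blast
    moreover have "(norm (x - p))\<^sup>2 \<le> d + 1 / real (Suc n)" using p[of n] by (auto simp: C_def)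
    ultimately show "(norm (x - p))\<^sup>2 \<le> d + e" by (simp add: inverse_eq_divide)
  qed
  have "inner (x - p) v = 0" if v: "v \<in> M" for v
  proof (cases "v = 0")
    case False
    \<comment> \<open>The value of \<open>r\<close> minimizes the distance from \<open>x\<close> to the line \<open>p + r v\<close>.\<close>
    define r where "r = inner (x - p) v / (norm v)\<^sup>2"
    have "p + r *\<^sub>R v \<in> M" using pM v assms(1) by (auto intro: subspace_add subspace_scale)
    then have "(norm (x - p))\<^sup>2 \<le> (norm ((x - p) - r *\<^sub>R v))\<^sup>2"
      using pd dle[of "p + r *\<^sub>R v"] unfolding diff_diff_eq by linarith
    then have "0 \<le> - (inner (x - p) v)\<^sup>2 / (norm v)\<^sup>2"
      unfolding norm_diff_scaleR using False by (simp add: r_def field_simps power2_eq_square)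
    then show ?thesis using False by (simp add: field_simps)
  qed simp
  with pM show ?thesis using that by blast
qed

lemma orthogonal_projection_cinner:
  fixes M :: "'a::complex_hilbert_space set"
  assumes "complex_vector.subspace M" "closed M"
  obtains p where "p \<in> M" "\<And>v. v \<in> M \<Longrightarrow> cinner (x - p) v = 0"
proof -
  have "subspace M"
    using assms(1) by (auto simp: subspace_def complex_vector.subspace_def scaleR_scaleC)
  then obtain p where p: "p \<in> M" "\<And>v. v \<in> M \<Longrightarrow> inner (x - p) v = 0"
    using orthogonal_projection_exists[OF _ assms(2)] by metis
  have "cinner (x - p) v = 0" if "v \<in> M" for v
    using p(2)[OF that] p(2)[of "\<i> *\<^sub>C v"] that assms(1)
    by (simp add: cinner_eq_Complex_inner complex_vector.subspace_scale complex_eq_iff)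
  with p(1) show ?thesis using that by blast
qed

lemma riesz_representation:
  fixes f :: "'a::{real_inner, complete_space} \<Rightarrow> real"
  assumes "bounded_linear f"
  obtains u where "\<And>x. f x = inner x u"
proof (cases "\<forall>x. f x = 0")
  case True
  then show ?thesis using that[of 0] by simp
next
  case False
  then obtain z where z: "f z \<noteq> 0" by blast
  interpret f: bounded_linear f by fact
  define M where "M = {x. f x = 0}"
  have "subspace M" by (auto simp: M_def subspace_def f.add f.scale f.zero)
  moreover have "closed M"
    unfolding M_def by (intro closed_Collect_eq continuous_intros linear_continuous_on assms)
  ultimately obtain p where p: "p \<in> M" "\<And>v. v \<in> M \<Longrightarrow> inner (z - p) v = 0"
    using orthogonal_projection_exists by metis
  define w where "w = z - p"
  have fw: "f w \<noteq> 0" using z p(1) by (simp add: w_def f.diff M_def)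
  then have w0: "w \<noteq> 0" using f.zero by auto
  have "f x = inner x ((f w / (norm w)\<^sup>2) *\<^sub>R w)" for x
  proof -
    have "x - (f x / f w) *\<^sub>R w \<in> M" using fw by (simp add: M_def f.diff f.scale)
    then have "inner w (x - (f x / f w) *\<^sub>R w) = 0" using p(2) by (simp add: w_def)
    then have "inner x w = f x / f w * (norm w)\<^sup>2"
      by (simp add: inner_diff_right power2_norm_eq_inner inner_commute)
    then show ?thesis using fw w0 by simp
  qed
  then show ?thesis by (rule that)
qed

lemma adjoint_exists:
  fixes T :: "'a::complex_hilbert_space \<Rightarrow> 'a"
  assumes T: "bounded_clinear T"
  obtains U where "bounded_clinear U" "\<And>x y. cinner (T x) y = cinner x (U y)"
proof -
  have "\<exists>u. \<forall>x. inner (T x) y = inner x u" for y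
    using riesz_representation[OF bounded_linear_compose[OF bounded_linear_inner_left[of y] bounded_clinearD(1)[OF T]]]
    by metis
  then obtain U where U: "\<And>x y. inner (T x) y = inner x (U y)" by metis
  have adj: "cinner (T x) y = cinner x (U y)" for x y
  proof -
    have "Im (cinner (T x) y) = - inner (T (\<i> *\<^sub>C x)) y" "Im (cinner x (U y)) = - inner (\<i> *\<^sub>C x) (U y)"
      by (simp_all add: inner_eq_Re_cinner bounded_clinearD(6)[OF T] cinner_scaleC_left)
    then show ?thesis
      using U[of x y] U[of "\<i> *\<^sub>C x" y] by (simp add: complex_eq_iff inner_eq_Re_cinner)
  qed
  have uniq: "u = v" if "\<And>x. cinner x u = cinner x v" for u v :: 'a
  proof -
    have "cinner (u - v) (u - v) = 0" using that by (simp add: cinner_diff(2))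
    then show ?thesis by (simp add: cinner_self)
  qed
  obtain K where K: "\<And>x. norm (T x) \<le> K * norm x" using bounded_clinear_bound[OF T] by metis
  have "bounded_clinear U"
  proof (rule bounded_clinearI[where K = K])
    show "U (x + y) = U x + U y" for x y
      by (rule uniq) (simp add: adj[symmetric] cinner_add_right)
    show "U (c *\<^sub>C x) = c *\<^sub>C U x" for c x
      by (rule uniq) (simp add: adj[symmetric] cinner_scaleC_right)
    show "norm (U y) \<le> norm y * K" for y
    proof (cases "U y = 0")
      case True
      have "0 \<le> K * norm y" using K[of y] norm_ge_zero order_trans by blast
      then show ?thesis using True by (simp add: mult.commute)
    next
      case False
      have "norm (U y) * norm (U y) = inner (T (U y)) y"
        by (simp add: U power2_norm_eq_inner[symmetric] power2_eq_square)
      also have "\<dots> \<le> norm (T (U y)) * norm y" by (rule norm_cauchy_schwarz)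
      also have "\<dots> \<le> K * norm (U y) * norm y" using K by (simp add: mult_right_mono)
      finally have "norm (U y) * norm (U y) \<le> norm (U y) * (norm y * K)" by (simp add: ac_simps)
      then show ?thesis using False by simp
    qed
  qed
  with adj show ?thesis using that by blast
qed

text \<open>
  The definite description behind \<^const>\<open>adjoint_op\<close> is justified: the adjoint exists by Riesz
  representation and is determined by its defining identity.
\<close>

lemma adjoint_op:
  assumes "bounded_clinear T"
  shows "bounded_clinear (adjoint_op T)" "cinner (T x) y = cinner x (adjoint_op T y)"
proof -
  obtain U where U: "bounded_clinear U" "\<And>x y. cinner (T x) y = cinner x (U y)"
    using adjoint_exists[OF assms] by metis
  have "adjoint_op T = U"
    unfolding adjoint_op_def
  proof (rule the_equality)
    fix V assume V: "bounded_clinear V \<and> (\<forall>x y. cinner (T x) y = cinner x (V y))"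
    show "V = U"
    proof
      fix y
      have "cinner (V y - U y) (V y - U y) = 0" using U(2) V by (simp add: cinner_diff(2))
      then show "V y = U y" by (simp add: cinner_self)
    qed
  qed (use U in auto)
  with U show "bounded_clinear (adjoint_op T)" "cinner (T x) y = cinner x (adjoint_op T y)" by auto
qed

section \<open>Orthonormal sequences\<close>

definition orthonormal :: "(nat \<Rightarrow> 'a::complex_inner) \<Rightarrow> bool" where
  "orthonormal e \<longleftrightarrow> (\<forall>m n. cinner (e m) (e n) = (if m = n then 1 else 0))"

definition ortho_sum :: "(nat \<Rightarrow> 'a::complex_inner) \<Rightarrow> nat set \<Rightarrow> 'a \<Rightarrow> 'a" where
  "ortho_sum e I x = (\<Sum>i\<in>I. cinner x (e i) *\<^sub>C e i)"

lemma orthonormal_cinner_sum: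
  assumes "orthonormal e" "finite I"
  shows "cinner (\<Sum>i\<in>I. c i *\<^sub>C e i) (e k) = (if k \<in> I then c k else 0)"
  using assms
  by (simp add: cinner_sum_left cinner_scaleC_left orthonormal_def if_distrib[of "(*) _"]
      cong: if_cong)

lemma norm_orthonormal:
  assumes "orthonormal e" shows "norm (e n) = 1"
proof -
  have "complex_of_real ((norm (e n))\<^sup>2) = 1"
    using assms unfolding cinner_self[symmetric] by (simp add: orthonormal_def)
  then have "(norm (e n))\<^sup>2 = 1" using of_real_eq_1_iff by blast
  then show ?thesis by (metis norm_ge_zero abs_of_nonneg power2_eq_1_iff real_sqrt_abs real_sqrt_one)
qed

lemma inj_orthonormal: "orthonormal e \<Longrightarrow> inj e"
  by (rule injI) (metis orthonormal_def zero_neq_one)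

lemma norm_orthonormal_sum:
  assumes "orthonormal e" "finite I"
  shows "(norm (\<Sum>i\<in>I. c i *\<^sub>C e i))\<^sup>2 = (\<Sum>i\<in>I. (cmod (c i))\<^sup>2)"
proof -
  have "complex_of_real ((norm (\<Sum>i\<in>I. c i *\<^sub>C e i))\<^sup>2) = (\<Sum>i\<in>I. cnj (c i) * c i)"
    unfolding cinner_self[symmetric]
    by (subst cinner_sum_right)
      (simp add: cinner_scaleC_right orthonormal_cinner_sum[OF assms])
  also have "\<dots> = complex_of_real (\<Sum>i\<in>I. (cmod (c i))\<^sup>2)"
    by (simp add: complex_norm_square[symmetric] mult.commute)
  finally show ?thesis using of_real_eq_iff by blast
qed

lemma ortho_sum_residual:
  assumes "orthonormal e" "finite I"
  shows "i \<in> I \<Longrightarrow> cinner (x - ortho_sum e I x) (e i) = 0"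
    and "(norm x)\<^sup>2 = (norm (x - ortho_sum e I x))\<^sup>2 + (\<Sum>i\<in>I. (cmod (cinner x (e i)))\<^sup>2)"
    and "norm (x - ortho_sum e I x) \<le> norm x"
    and "(\<Sum>i\<in>I. (cmod (cinner x (e i)))\<^sup>2) \<le> (norm x)\<^sup>2"
proof -
  show ort: "cinner (x - ortho_sum e I x) (e i) = 0" if "i \<in> I" for i
    using that by (simp add: cinner_diff ortho_sum_def orthonormal_cinner_sum[OF assms])
  have "cinner (x - ortho_sum e I x) (ortho_sum e I x) = 0"
    by (subst (2) ortho_sum_def) (simp add: cinner_sum_right cinner_scaleC_right ort)
  then show pyth: "(norm x)\<^sup>2 = (norm (x - ortho_sum e I x))\<^sup>2 + (\<Sum>i\<in>I. (cmod (cinner x (e i)))\<^sup>2)"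
    using norm_add_orthogonal[of "x - ortho_sum e I x" "ortho_sum e I x"]
    by (simp add: ortho_sum_def norm_orthonormal_sum[OF assms])
  show "norm (x - ortho_sum e I x) \<le> norm x"
    by (rule power2_le_imp_le) (use pyth in \<open>auto simp: sum_nonneg\<close>)
  show "(\<Sum>i\<in>I. (cmod (cinner x (e i)))\<^sup>2) \<le> (norm x)\<^sup>2"
    using pyth by simp
qed

section \<open>Compact operators attain their norm at eigenvectors\<close>

lemma cinner_adjoint_op_left:
  assumes "bounded_clinear S"
  shows "cinner (adjoint_op S y) x = cinner y (S x)"
  by (metis adjoint_op(2)[OF assms] cinner_commute)

lemma compact_op_subsequence:
  assumes "compact_op S" "\<And>n. norm (x n) \<le> 1"
  obtains r y where "strict_mono (r :: nat \<Rightarrow> nat)" "(\<lambda>k. S (x (r k))) \<longlonglongrightarrow> y"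
proof -
  have "S (x n) \<in> closure (S ` cball 0 1)" for n
    using assms(2)[of n] closure_subset[of "S ` cball 0 1"] by auto
  moreover have "compact (closure (S ` cball 0 1))" using assms(1) by (simp add: compact_op_def)
  ultimately obtain r y where "strict_mono (r :: nat \<Rightarrow> nat)" "((\<lambda>n. S (x n)) \<circ> r) \<longlonglongrightarrow> y"
    unfolding compact_def by metis
  then show ?thesis using that by (simp add: o_def)
qed

text \<open>
  Let \<open>s\<close> be the norm of \<open>S\<close> restricted to a closed subspace \<open>M\<close> that is invariant under
  \<open>S\<^sup>*S\<close>. A maximizing sequence of unit vectors \<open>w\<close> satisfies \<open>S\<^sup>*S w - s\<^sup>2 w \<longlonglongrightarrow> 0\<close>. Compactness lets
  \<open>S w\<close>, hence \<open>S\<^sup>*S w\<close>, converge along a subsequence; when \<open>s > 0\<close> this forces \<open>w\<close> itself to converge, and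
  the limit is an eigenvector in \<open>M\<close> at which the norm is attained.
\<close>

lemma compact_op_norm_attained:
  fixes S :: "'a::complex_hilbert_space \<Rightarrow> 'a"
  assumes S: "compact_op S"
    and M: "complex_vector.subspace M" "closed M"
    and inv: "\<And>v. v \<in> M \<Longrightarrow> adjoint_op S (S v) \<in> M"
    and nontriv: "u \<in> M" "norm u = 1"
  obtains x where "x \<in> M" "norm x = 1"
    "adjoint_op S (S x) = complex_of_real ((norm (S x))\<^sup>2) *\<^sub>C x"
    "\<And>v. v \<in> M \<Longrightarrow> norm (S v) \<le> norm (S x) * norm v"
proof -
  have bS: "bounded_clinear S" using S by (simp add: compact_op_def)
  note bA = adjoint_op(1)[OF bS]
  define T where "T v = adjoint_op S (S v)" for v
  have bT: "bounded_clinear T"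
    using bounded_clinear_comp[OF bA bS] by (simp add: T_def[abs_def] o_def)
  obtain K where K: "\<And>x. norm (S x) \<le> K * norm x" using bounded_clinear_bound[OF bS] by metis
  define U where "U = {v \<in> M. norm v = 1}"
  define s where "s = (SUP v\<in>U. norm (S v))"
  have Une: "U \<noteq> {}" using nontriv by (auto simp: U_def)
  have bdd: "bdd_above ((\<lambda>v. norm (S v)) ` U)"
  proof (rule bdd_aboveI2)
    show "norm (S v) \<le> K" if "v \<in> U" for v using K[of v] that by (simp add: U_def)
  qed
  have s0: "0 \<le> s"
    unfolding s_def using nontriv by (intro cSUP_upper2[OF bdd, of u]) (auto simp: U_def)
  have Sle: "norm (S v) \<le> s * norm v" if "v \<in> M" for v
  proof (cases "v = 0")
    case False
    have "(1 / norm v) *\<^sub>R v \<in> U"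
      using False that M(1) by (simp add: U_def scaleR_scaleC complex_vector.subspace_scale norm_scaleC norm_divide)
    then have "norm (S ((1 / norm v) *\<^sub>R v)) \<le> s"
      unfolding s_def by (intro cSUP_upper bdd)
    then show ?thesis using False by (simp add: bounded_clinearD(7)[OF bS] field_simps)
  qed (simp add: bounded_clinearD(5)[OF bS])
  have TS: "inner (T v) v = (norm (S v))\<^sup>2" for v
    by (simp add: T_def inner_eq_Re_cinner cinner_adjoint_op_left[OF bS] cinner_self)
  have Tle: "norm (T v) \<le> s\<^sup>2 * norm v" if "v \<in> M" for v
  proof (cases "T v = 0")
    case False
    have "norm (T v) * norm (T v) = inner (S v) (S (T v))"
      by (simp add: power2_norm_eq_inner[symmetric] power2_eq_square[symmetric])
        (simp add: power2_norm_eq_inner, simp add: T_def inner_eq_Re_cinner cinner_adjoint_op_left[OF bS])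
    also have "\<dots> \<le> norm (S v) * norm (S (T v))" by (rule norm_cauchy_schwarz)
    also have "\<dots> \<le> (s * norm v) * (s * norm (T v))"
      using that inv[OF that] s0 by (intro mult_mono Sle) (auto simp: T_def)
    finally have "norm (T v) * norm (T v) \<le> norm (T v) * (s\<^sup>2 * norm v)"
      by (simp add: power2_eq_square ac_simps)
    then show ?thesis using False by simp
  qed (use s0 in auto)
  show ?thesis
  proof (cases "s = 0")
    case True
    have "norm (S v) \<le> norm (S u) * norm v" if "v \<in> M" for v
      using Sle[OF that] True by (simp add: order_trans[OF _ mult_nonneg_nonneg])
    moreover have "S u = 0" "T u = 0" using Sle[OF nontriv(1)] Tle[OF nontriv(1)] True by auto
    ultimately show ?thesis using nontriv that[of u] by (simp add: T_def)
  next
    case False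
    then have s_pos: "0 < s" using s0 by simp
    have "\<exists>v\<in>U. s - 1 / real (Suc k) < norm (S v)" for k
    proof -
      have "s - 1 / real (Suc k) < s" by simp
      then show ?thesis unfolding s_def using less_cSUP_iff[OF Une bdd] by blast
    qed
    then obtain w where w: "\<And>k. w k \<in> U" "\<And>k. s - 1 / real (Suc k) < norm (S (w k))" by metis
    have wM: "w k \<in> M" and wn: "norm (w k) = 1" for k using w(1) by (auto simp: U_def)
    have lim_s: "(\<lambda>k. norm (S (w k))) \<longlonglongrightarrow> s"
    proof (rule tendsto_sandwich)
      show "(\<lambda>k. s - 1 / real (Suc k)) \<longlonglongrightarrow> s"
        using tendsto_diff[OF tendsto_const LIMSEQ_inverse_real_of_nat, of s]
        by (simp add: inverse_eq_divide)
      show "(\<lambda>k. s) \<longlonglongrightarrow> s" by simp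
      show "\<forall>\<^sub>F k in sequentially. norm (S (w k)) \<le> s" using Sle[OF wM] wn by simp
    qed (use w(2) less_imp_le in \<open>auto intro!: always_eventually\<close>)
    \<comment> \<open>A maximizing sequence consists of approximate eigenvectors of \<open>S\<^sup>*S\<close>.\<close>
    have lim0: "(\<lambda>k. T (w k) - s\<^sup>2 *\<^sub>R w k) \<longlonglongrightarrow> 0"
    proof -
      have bound: "(norm (T (w k) - s\<^sup>2 *\<^sub>R w k))\<^sup>2 \<le> 2 * s\<^sup>2 * (s\<^sup>2 - (norm (S (w k)))\<^sup>2)" for k
      proof -
        have "(norm (T (w k)))\<^sup>2 \<le> (s\<^sup>2)\<^sup>2"
          using Tle[OF wM, of k] wn by (intro power_mono) auto
        then show ?thesis
          unfolding norm_diff_scaleR TS wn by (simp add: algebra_simps power2_eq_square)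
      qed
      have lim: "(\<lambda>k. 2 * s\<^sup>2 * (s\<^sup>2 - (norm (S (w k)))\<^sup>2)) \<longlonglongrightarrow> 2 * s\<^sup>2 * (s\<^sup>2 - s\<^sup>2)"
        by (intro tendsto_intros lim_s)
      have "(\<lambda>k. (norm (T (w k) - s\<^sup>2 *\<^sub>R w k))\<^sup>2) \<longlonglongrightarrow> 0"
        by (rule tendsto_sandwich[OF _ _ tendsto_const])
          (use bound lim in \<open>auto intro: always_eventually\<close>)
      from tendsto_real_sqrt[OF this] show ?thesis by (simp add: tendsto_norm_zero_iff)
    qed
    obtain r y where r: "strict_mono (r :: nat \<Rightarrow> nat)" and y: "(\<lambda>k. S (w (r k))) \<longlonglongrightarrow> y"
      using compact_op_subsequence[OF S, of w] wn by auto
    define x where "x = (1 / s\<^sup>2) *\<^sub>R adjoint_op S y"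
    have limT: "(\<lambda>k. T (w (r k))) \<longlonglongrightarrow> adjoint_op S y"
      unfolding T_def by (rule bounded_linear.tendsto[OF bounded_clinearD(1)[OF bA] y])
    have "(\<lambda>k. (1 / s\<^sup>2) *\<^sub>R (T (w (r k)) - (T (w (r k)) - s\<^sup>2 *\<^sub>R w (r k)))) \<longlonglongrightarrow> (1 / s\<^sup>2) *\<^sub>R (adjoint_op S y - 0)"
      by (intro tendsto_intros limT LIMSEQ_subseq_LIMSEQ[OF lim0 r, unfolded o_def])
    then have wx: "(\<lambda>k. w (r k)) \<longlonglongrightarrow> x" using s_pos by (simp add: x_def)
    have xM: "x \<in> M" using closed_sequentially[OF M(2), of "\<lambda>k. w (r k)"] wM wx by blast
    have "(\<lambda>k. norm (w (r k))) \<longlonglongrightarrow> norm x" by (intro tendsto_norm wx)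
    then have xn: "norm x = 1" by (simp add: wn LIMSEQ_const_iff)
    have lSx: "(\<lambda>k. S (w (r k))) \<longlonglongrightarrow> S x"
      by (rule bounded_linear.tendsto[OF bounded_clinearD(1)[OF bS] wx])
    then have "y = S x" using y LIMSEQ_unique by blast
    have "(\<lambda>k. norm (S (w (r k)))) \<longlonglongrightarrow> norm (S x)" by (intro tendsto_norm lSx)
    then have Sx: "norm (S x) = s"
      by (rule LIMSEQ_unique[OF _ LIMSEQ_subseq_LIMSEQ[OF lim_s r, unfolded o_def]])
    have "adjoint_op S y = s\<^sup>2 *\<^sub>R x" using s_pos by (simp add: x_def)
    then have "adjoint_op S (S x) = s\<^sup>2 *\<^sub>R x" by (simp only: \<open>y = S x\<close>)
    then have "adjoint_op S (S x) = complex_of_real ((norm (S x))\<^sup>2) *\<^sub>C x"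
      by (simp only: Sx scaleR_scaleC)
    then show ?thesis using that[OF xM xn] Sle Sx by metis
  qed
qed

section \<open>Singular systems\<close>

text \<open>
  An orthonormal sequence of eigenvectors of \<open>S\<^sup>*S\<close>, chosen greedily: the condition \<open>tail\<close> says that
  \<open>e n\<close> maximizes \<open>norm (S v)\<close> among the unit vectors \<open>v\<close> orthogonal to its predecessors. The norms \<open>norm (S (e n))\<close>
  are the singular values of \<open>S\<close>. If \<open>S\<close> has finite rank, then from some
  index on \<open>e n\<close> lies in its kernel. The sequence does not have to be complete, but \<open>S\<close>
  vanishes on the vectors orthogonal to it.
\<close>

locale singular_system =
  fixes S :: "'a::complex_hilbert_space \<Rightarrow> 'a" and e :: "nat \<Rightarrow> 'a"
  assumes compact: "compact_op S" and ortho: "orthonormal e"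
    and eig: "adjoint_op S (S (e n)) = complex_of_real ((norm (S (e n)))\<^sup>2) *\<^sub>C e n"
    and tail: "(\<And>i. i < n \<Longrightarrow> cinner v (e i) = 0) \<Longrightarrow> norm (S v) \<le> norm (S (e n)) * norm v"

lemma finite_orthonormal_extend:
  fixes f :: "nat \<Rightarrow> 'a::complex_inner"
  assumes inf: "\<nexists>F::'a set. finite F \<and> complex_vector.span F = UNIV"
    and ort: "\<And>i j. i < n \<Longrightarrow> j < n \<Longrightarrow> cinner (f i) (f j) = (if i = j then 1 else 0)"
  obtains u where "norm u = 1" "\<And>i. i < n \<Longrightarrow> cinner u (f i) = 0"
proof -
  have "complex_vector.span (f ` {..<n}) \<noteq> UNIV" using inf by blast
  then obtain x where x: "x \<notin> complex_vector.span (f ` {..<n})" by blast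
  define z where "z = x - (\<Sum>i<n. cinner x (f i) *\<^sub>C f i)"
  have "(\<Sum>i<n. cinner x (f i) *\<^sub>C f i) \<in> complex_vector.span (f ` {..<n})"
    by (intro complex_vector.span_sum complex_vector.span_scale complex_vector.span_base) auto
  then have z0: "z \<noteq> 0" using x by (auto simp: z_def)
  have "cinner z (f j) = 0" if "j < n" for j
  proof -
    have "cinner (\<Sum>i<n. cinner x (f i) *\<^sub>C f i) (f j) = (\<Sum>i<n. if i = j then cinner x (f i) else 0)"
      unfolding cinner_sum_left by (rule sum.cong) (auto simp: cinner_scaleC_left ort that)
    then show ?thesis using that by (simp add: z_def cinner_diff)
  qed
  then show ?thesis
    using z0 that[of "(1 / norm z) *\<^sub>R z"] by (simp add: scaleR_scaleC cinner_scaleC_left norm_scaleC norm_divide)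
qed

text \<open>
  The orthogonal complement of eigenvectors \<open>f 0, \<dots>, f (n - 1)\<close> of the self-adjoint \<open>S\<^sup>*S\<close> is
  invariant under \<open>S\<^sup>*S\<close>, and it is nonzero because the space has infinite dimension. So a vector
  where \<open>S\<close> attains its norm on this complement can always be taken as the next eigenvector.
\<close>

lemma singular_system_exists:
  fixes S :: "'a::complex_hilbert_space \<Rightarrow> 'a"
  assumes inf: "\<nexists>F::'a set. finite F \<and> complex_vector.span F = UNIV"
    and S: "compact_op S"
  obtains e where "singular_system S e"
proof -
  have bS: "bounded_clinear S" using S by (simp add: compact_op_def)
  define Q where "Q f n r \<longleftrightarrow> norm r = 1 \<and> (\<forall>i<n. cinner r (f i) = 0) \<and>
     adjoint_op S (S r) = complex_of_real ((norm (S r))\<^sup>2) *\<^sub>C r \<and>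
     (\<forall>v. (\<forall>i<n. cinner v (f i) = 0) \<longrightarrow> norm (S v) \<le> norm (S r) * norm v)"
    for f and n :: nat and r
  have ort: "cinner (f i) (f j) = (if i = j then 1 else 0)"
    if "\<And>k. k < n \<Longrightarrow> Q f k (f k)" "i < n" "j < n" for f n i j
    using that(1)[OF that(2)] that(1)[OF that(3)]
    by (cases i j rule: linorder_cases)
      (auto simp: Q_def cinner_self cinner_eq_0_commute)
  have "\<exists>f. \<forall>n. Q f n (f n)"
  proof (rule dependent_wellorder_choice)
    show "Q f n r = Q g n r" if "\<And>k. k < n \<Longrightarrow> f k = g k" for r f g n
      using that by (simp add: Q_def)
    fix n f assume Q: "\<And>k. k < n \<Longrightarrow> Q f k (f k)"
    define M where "M = {v. \<forall>i<n. cinner v (f i) = 0}"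
    have "complex_vector.subspace M"
      by (auto simp: M_def complex_vector.subspace_def cinner_add_left cinner_scaleC_left)
    moreover have "closed M"
    proof -
      have "M = (\<Inter>i\<in>{..<n}. {v. cinner v (f i) = 0})" by (auto simp: M_def)
      then show ?thesis
        by (auto intro!: closed_INT closed_Collect_eq linear_continuous_on bounded_linear_cinner_left)
    qed
    moreover have "adjoint_op S (S v) \<in> M" if "v \<in> M" for v
      unfolding M_def
    proof clarify
      fix i assume "i < n"
      have "cinner (adjoint_op S (S v)) (f i) = cinner v (adjoint_op S (S (f i)))"
        by (simp add: cinner_adjoint_op_left[OF bS] adjoint_op(2)[OF bS])
      also have "\<dots> = 0"
        using Q[OF \<open>i < n\<close>] that \<open>i < n\<close> by (simp add: Q_def M_def cinner_scaleC_right)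
      finally show "cinner (adjoint_op S (S v)) (f i) = 0" .
    qed
    moreover obtain u where "norm u = 1" "\<And>i. i < n \<Longrightarrow> cinner u (f i) = 0"
      using finite_orthonormal_extend[OF inf, of n f] ort[OF Q] by metis
    ultimately obtain x where "x \<in> M" "norm x = 1"
      "adjoint_op S (S x) = complex_of_real ((norm (S x))\<^sup>2) *\<^sub>C x"
      "\<And>v. v \<in> M \<Longrightarrow> norm (S v) \<le> norm (S x) * norm v"
      using compact_op_norm_attained[OF S, of M u] unfolding M_def by blast
    then show "\<exists>r. Q f n r" unfolding M_def Q_def by (intro exI[of _ x]) auto
  qed
  then obtain f where f: "\<And>n. Q f n (f n)" by blast
  have "orthonormal f"
    unfolding orthonormal_def
  proof (intro allI)
    fix m n show "cinner (f m) (f n) = (if m = n then 1 else 0)"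
      by (rule ort[of "Suc (max m n)"]) (use f in auto)
  qed
  then show ?thesis using that[of f] f S unfolding singular_system_def Q_def by blast
qed

context singular_system
begin

lemma bounded: "bounded_clinear S"
  using compact by (simp add: compact_op_def)

lemma images_orthogonal:
  "cinner (S (e m)) (S (e n)) = (if m = n then complex_of_real ((norm (S (e n)))\<^sup>2) else 0)"
  using ortho unfolding adjoint_op(2)[OF bounded] eig
  by (simp add: cinner_scaleC_right orthonormal_def)

lemma decseq_singular: "decseq (\<lambda>n. norm (S (e n)))"
  unfolding decseq_def
proof (intro allI impI)
  fix m n :: nat assume "m \<le> n"
  then have "norm (S (e n)) \<le> norm (S (e m)) * norm (e n)"
    using ortho by (intro tail) (auto simp: orthonormal_def)
  then show "norm (S (e n)) \<le> norm (S (e m))" by (simp add: norm_orthonormal[OF ortho])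
qed

text \<open>
  The vectors \<open>S (e n)\<close> are pairwise orthogonal, so if their norms stayed above \<open>\<epsilon>\<close>, no subsequence
  of them could be Cauchy, against compactness of \<open>S\<close>.
\<close>

lemma singular_tendsto_0: "(\<lambda>n. norm (S (e n))) \<longlonglongrightarrow> 0"
proof (rule LIMSEQ_I)
  fix \<epsilon> :: real assume \<epsilon>: "0 < \<epsilon>"
  have "\<exists>n. norm (S (e n)) < \<epsilon>"
  proof (rule ccontr)
    assume "\<not> ?thesis"
    then have big: "\<epsilon> \<le> norm (S (e n))" for n by (simp add: not_less)
    obtain r y where r: "strict_mono (r :: nat \<Rightarrow> nat)" and y: "(\<lambda>k. S (e (r k))) \<longlonglongrightarrow> y"
      using compact_op_subsequence[OF compact, of e] norm_orthonormal[OF ortho] by auto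
    have "Cauchy (\<lambda>k. S (e (r k)))" using y by (rule LIMSEQ_imp_Cauchy)
    then obtain N where "norm (S (e (r N)) - S (e (r (Suc N)))) < \<epsilon>"
      using \<epsilon> unfolding Cauchy_iff by (meson le_Suc_eq order_refl)
    moreover have "r N \<noteq> r (Suc N)" using r by (simp add: strict_mono_eq)
    then have "(norm (S (e (r N)) + - S (e (r (Suc N)))))\<^sup>2
        = (norm (S (e (r N))))\<^sup>2 + (norm (- S (e (r (Suc N)))))\<^sup>2"
      by (intro norm_add_orthogonal) (simp add: images_orthogonal)
    then have "(norm (S (e (r N))))\<^sup>2 \<le> (norm (S (e (r N)) - S (e (r (Suc N)))))\<^sup>2" by simp
    then have "norm (S (e (r N))) \<le> norm (S (e (r N)) - S (e (r (Suc N))))"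
      by (rule power2_le_imp_le) simp
    ultimately show False using big[of "r N"] by simp
  qed
  then obtain N where "norm (S (e N)) < \<epsilon>" by blast
  then have "norm (norm (S (e n)) - 0) < \<epsilon>" if "N \<le> n" for n
    using decseqD[OF decseq_singular that] by simp
  then show "\<exists>N. \<forall>n\<ge>N. norm (norm (S (e n)) - 0) < \<epsilon>" by blast
qed

text \<open>
  A substitute for completeness of the system: an operator that kills every \<open>e n\<close> and is small on the
  orthogonal complements of the initial segments, in the way \<open>S\<close> is, must be zero. Identities
  between operators can thereby be checked on the vectors \<open>e n\<close> alone.
\<close>

lemma vanishing:
  assumes D: "bounded_clinear D" "\<And>n. D (e n) = 0"
    and D_tail: "\<And>n v. (\<And>i. i < n \<Longrightarrow> cinner v (e i) = 0) \<Longrightarrow> norm (D v) \<le> C * norm (S (e n)) * norm v"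
    and C: "0 \<le> C"
  shows "D x = 0"
proof -
  have bound: "norm (D x) \<le> C * norm (S (e n)) * norm x" for n
  proof -
    let ?r = "x - ortho_sum e {..<n} x"
    have "D (ortho_sum e {..<n} x) = 0"
      by (simp add: ortho_sum_def bounded_clinearD(8,6)[OF D(1)] D(2))
    then have "D x = D ?r" by (simp add: bounded_clinearD(3)[OF D(1)])
    also have "norm (D ?r) \<le> C * norm (S (e n)) * norm ?r"
      by (intro D_tail) (simp add: ortho_sum_residual(1)[OF ortho])
    also have "\<dots> \<le> C * norm (S (e n)) * norm x"
      using C by (intro mult_left_mono ortho_sum_residual(3)[OF ortho]) auto
    finally show ?thesis .
  qed
  have "(\<lambda>n. C * norm (S (e n)) * norm x) \<longlonglongrightarrow> C * 0 * norm x"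
    by (intro tendsto_intros singular_tendsto_0)
  then have "norm (D x) \<le> 0" using bound LIMSEQ_le_const[of _ _ "norm (D x)"] by fastforce
  then show ?thesis by simp
qed

end

section \<open>The absolute value of a compact operator\<close>

text \<open>
  Polarization: the quadratic form of \<open>P\<close> is real at \<open>x\<close>, \<open>y\<close>, \<open>x + y\<close> and \<open>x + \<i> y\<close>.
\<close>

lemma positive_op_self_adjoint:
  assumes "positive_op P"
  shows "cinner (P x) y = cinner x (P y)"
proof -
  have bP: "bounded_clinear P" and real: "Im (cinner (P z) z) = 0" for z
    using assms by (simp_all add: positive_op_def complex_nonneg_Reals_iff)
  have "Im (cinner (P x) y) + Im (cinner (P y) x) = 0"
    using real[of "x + y"] real[of x] real[of y]
    by (simp add: bounded_clinearD(2)[OF bP] cinner_add_left cinner_add_right)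
  moreover have "Re (cinner (P x) y) = Re (cinner (P y) x)"
    using real[of "x + \<i> *\<^sub>C y"] real[of x] real[of y]
    by (simp add: bounded_clinearD(2,6)[OF bP] cinner_add_left cinner_add_right
        cinner_scaleC_left cinner_scaleC_right)
  moreover have "cinner x (P y) = cnj (cinner (P y) x)" by (rule cinner_commute)
  ultimately show ?thesis by (simp add: complex_eq_iff)
qed

context singular_system
begin

abbreviation s :: "nat \<Rightarrow> real" where "s n \<equiv> norm (S (e n))"

definition root_sum :: "nat set \<Rightarrow> 'a \<Rightarrow> 'a" where
  "root_sum I x = (\<Sum>i\<in>I. (complex_of_real (s i) * cinner x (e i)) *\<^sub>C e i)"

lemma norm_root_sum_le: "norm (root_sum {m..<n} x) \<le> s m * norm x"
proof (rule power2_le_imp_le)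
  have "(norm (root_sum {m..<n} x))\<^sup>2 = (\<Sum>i=m..<n. (s i)\<^sup>2 * (cmod (cinner x (e i)))\<^sup>2)"
    by (simp add: root_sum_def norm_orthonormal_sum[OF ortho] norm_mult power_mult_distrib)
  also have "\<dots> \<le> (\<Sum>i=m..<n. (s m)\<^sup>2 * (cmod (cinner x (e i)))\<^sup>2)"
    using decseqD[OF decseq_singular] by (intro sum_mono mult_right_mono power_mono) auto
  also have "\<dots> \<le> (s m)\<^sup>2 * (norm x)\<^sup>2"
    unfolding sum_distrib_left[symmetric]
    by (intro mult_left_mono ortho_sum_residual(4)[OF ortho]) auto
  finally show "(norm (root_sum {m..<n} x))\<^sup>2 \<le> (s m * norm x)\<^sup>2"
    by (simp add: power_mult_distrib)
qed simp

lemma root_sum_diff: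
  "m \<le> n \<Longrightarrow> root_sum {..<n} x - root_sum {..<m} x = root_sum {m..<n} x"
  unfolding root_sum_def
  by (subst sum_diff[symmetric]) (auto intro!: sum.cong)

lemma root_sum_convergent: "convergent (\<lambda>n. root_sum {..<n} x)"
proof (rule Cauchy_convergent, rule CauchyI')
  fix \<epsilon> :: real assume "0 < \<epsilon>"
  have "(\<lambda>n. s n * norm x) \<longlonglongrightarrow> 0 * norm x"
    by (intro tendsto_intros singular_tendsto_0)
  then have "\<forall>\<^sub>F n in sequentially. s n * norm x < \<epsilon>"
    using order_tendstoD(2)[of _ "0 * norm x"] \<open>0 < \<epsilon>\<close> by simp
  then obtain N where N: "\<And>n. N \<le> n \<Longrightarrow> s n * norm x < \<epsilon>"
    by (auto simp: eventually_sequentially)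
  have "norm (root_sum {..<m} x - root_sum {..<n} x) < \<epsilon>" if "N \<le> m" "m < n" for m n
    using N[OF that(1)] norm_root_sum_le[of m n x] root_sum_diff[of m n x] that(2)
    by (simp add: norm_minus_commute[of "root_sum {..<m} x"])
  then show "\<exists>M. \<forall>m\<ge>M. \<forall>n>m. dist (root_sum {..<m} x) (root_sum {..<n} x) < \<epsilon>"
    unfolding dist_norm by blast
qed

text \<open>
  The positive square root of \<open>S\<^sup>*S\<close>. The partial sums converge because \<open>s\<close> decreases to zero, which
  by Bessel's inequality bounds their tails by \<open>s m * norm x\<close>.
\<close>

definition pos_root :: "'a \<Rightarrow> 'a" where "pos_root x = lim (\<lambda>n. root_sum {..<n} x)"

lemma pos_root_tendsto: "(\<lambda>n. root_sum {..<n} x) \<longlonglongrightarrow> pos_root x"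
  using root_sum_convergent[of x] by (simp add: pos_root_def convergent_LIMSEQ_iff)

lemma norm_pos_root_tail:
  assumes "\<And>i. i < m \<Longrightarrow> cinner v (e i) = 0"
  shows "norm (pos_root v) \<le> s m * norm v"
proof (rule tendsto_upperbound[OF tendsto_norm[OF pos_root_tendsto]])
  have "root_sum {..<m} v = 0" using assms by (simp add: root_sum_def)
  then have "norm (root_sum {..<n} v) \<le> s m * norm v" if "m \<le> n" for n
    using root_sum_diff[OF that, of v] norm_root_sum_le[of m n v] by simp
  then show "\<forall>\<^sub>F n in sequentially. norm (root_sum {..<n} v) \<le> s m * norm v"
    by (auto simp: eventually_sequentially)
qed simp

lemma bounded_clinear_pos_root: "bounded_clinear pos_root"
proof (rule bounded_clinearI[where K = "s 0"])
  show "pos_root (x + y) = pos_root x + pos_root y" for x y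
  proof (rule LIMSEQ_unique[OF pos_root_tendsto])
    have "root_sum {..<n} (x + y) = root_sum {..<n} x + root_sum {..<n} y" for n
      by (simp add: root_sum_def cinner_add_left ring_distribs scaleC_add_left sum.distrib)
    then show "(\<lambda>n. root_sum {..<n} (x + y)) \<longlonglongrightarrow> pos_root x + pos_root y"
      using tendsto_add[OF pos_root_tendsto pos_root_tendsto] by simp
  qed
  have bc: "bounded_linear (\<lambda>x. c *\<^sub>C (x::'a))" for c
    by (rule bounded_linear_intro[where K = "cmod c"])
      (simp_all add: scaleC_add_right scaleR_scaleC scaleC_scaleC norm_scaleC mult.commute)
  show "pos_root (c *\<^sub>C x) = c *\<^sub>C pos_root x" for c x
  proof (rule LIMSEQ_unique[OF pos_root_tendsto])
    have "root_sum {..<n} (c *\<^sub>C x) = c *\<^sub>C root_sum {..<n} x" for n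
      by (simp add: root_sum_def cinner_scaleC_left complex_vector.scale_sum_right scaleC_scaleC ac_simps)
    then show "(\<lambda>n. root_sum {..<n} (c *\<^sub>C x)) \<longlonglongrightarrow> c *\<^sub>C pos_root x"
      using bounded_linear.tendsto[OF bc pos_root_tendsto] by simp
  qed
  show "norm (pos_root x) \<le> norm x * s 0" for x
    using norm_pos_root_tail[of 0 x] by (simp add: mult.commute)
qed

lemma pos_root_eigenvector: "pos_root (e n) = complex_of_real (s n) *\<^sub>C e n"
proof (rule LIMSEQ_unique[OF pos_root_tendsto])
  have "root_sum {..<k} (e n) = complex_of_real (s n) *\<^sub>C e n" if "Suc n \<le> k" for k
  proof -
    have "root_sum {..<k} (e n) = (\<Sum>i<k. if i = n then complex_of_real (s n) *\<^sub>C e n else 0)"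
      unfolding root_sum_def using ortho by (intro sum.cong) (auto simp: orthonormal_def)
    then show ?thesis using that by simp
  qed
  then show "(\<lambda>k. root_sum {..<k} (e n)) \<longlonglongrightarrow> complex_of_real (s n) *\<^sub>C e n"
    by (intro tendsto_eventually) (auto simp: eventually_sequentially)
qed

lemma positive_op_pos_root: "positive_op pos_root"
  unfolding positive_op_def
proof (intro conjI allI bounded_clinear_pos_root)
  fix x
  have "cinner (root_sum {..<n} x) x \<in> \<real>\<^sub>\<ge>\<^sub>0" for n
  proof -
    have "cinner (root_sum {..<n} x) x
        = (\<Sum>i<n. complex_of_real (s i) * cinner x (e i) * cnj (cinner x (e i)))"
      unfolding root_sum_def cinner_sum_left
      by (intro sum.cong refl) (metis cinner_scaleC_left cinner_commute)
    also have "\<dots> = complex_of_real (\<Sum>i<n. s i * (cmod (cinner x (e i)))\<^sup>2)"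
      by (simp add: complex_norm_square[symmetric] mult.assoc)
    also have "\<dots> \<in> \<real>\<^sub>\<ge>\<^sub>0"
      by (simp add: complex_nonneg_Reals_iff sum_nonneg)
    finally show ?thesis .
  qed
  then show "cinner (pos_root x) x \<in> \<real>\<^sub>\<ge>\<^sub>0"
    by (rule closed_sequentially[OF closed_nonneg_Reals_complex _ tendsto_cinner_left[OF pos_root_tendsto]])
qed

lemma pos_root_squared: "pos_root \<circ> pos_root = adjoint_op S \<circ> S"
proof -
  obtain K where K: "0 < K" "\<And>x. norm (adjoint_op S x) \<le> K * norm x"
    using bounded_clinear_bound[OF adjoint_op(1)[OF bounded]] by metis
  define D where "D x = pos_root (pos_root x) - adjoint_op S (S x)" for x
  have "D x = 0" for x
  proof (rule vanishing[where C = "s 0 + K" and D = D])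
    show "bounded_clinear D"
      using bounded_clinear_diff[OF bounded_clinear_comp[OF bounded_clinear_pos_root bounded_clinear_pos_root]
          bounded_clinear_comp[OF adjoint_op(1)[OF bounded] bounded]]
      by (simp add: D_def[abs_def] o_def)
    show "D (e n) = 0" for n
      by (simp add: D_def pos_root_eigenvector bounded_clinearD(6)[OF bounded_clinear_pos_root] eig
          scaleC_scaleC power2_eq_square)
    show "norm (D v) \<le> (s 0 + K) * s n * norm v" if "\<And>i. i < n \<Longrightarrow> cinner v (e i) = 0" for n v
    proof -
      have "norm (pos_root (pos_root v)) \<le> s 0 * norm (pos_root v)" by (rule norm_pos_root_tail) simp
      also have "\<dots> \<le> s 0 * (s n * norm v)" by (intro mult_left_mono norm_pos_root_tail that) auto
      finally have "norm (pos_root (pos_root v)) \<le> s 0 * (s n * norm v)" .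
      moreover have "norm (adjoint_op S (S v)) \<le> K * (s n * norm v)"
        using K(2)[of "S v"] tail[of n v] that K(1) by (meson mult_left_mono less_imp_le order_trans)
      moreover have "norm (D v) \<le> norm (pos_root (pos_root v)) + norm (adjoint_op S (S v))"
        unfolding D_def by (rule norm_triangle_ineq4)
      ultimately show ?thesis by (simp add: algebra_simps)
    qed
  qed (use K(1) in simp)
  then show ?thesis by (auto simp: D_def)
qed

text \<open>
  The square determines a positive operator on each eigenvector \<open>e n\<close> and determines its norm at
  every vector. The vanishing criterion then shows that there is only one positive square root.
\<close>

lemma positive_root_eigenvector:
  assumes P: "positive_op P" "P \<circ> P = adjoint_op S \<circ> S"
  shows "norm (P x) = norm (S x)" and "P (e n) = complex_of_real (s n) *\<^sub>C e n"
proof -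
  have bP: "bounded_clinear P" using P(1) by (simp add: positive_op_def)
  have PP: "P (P x) = adjoint_op S (S x)" for x using fun_cong[OF P(2), of x] by simp
  have "complex_of_real ((norm (P x))\<^sup>2) = complex_of_real ((norm (S x))\<^sup>2)" for x
    unfolding cinner_self[symmetric]
    by (simp add: positive_op_self_adjoint[OF P(1), of x] PP adjoint_op(2)[OF bounded])
  then have "(norm (P x))\<^sup>2 = (norm (S x))\<^sup>2" for x using of_real_eq_iff by blast
  then show nP: "norm (P x) = norm (S x)" for x by (simp add: power2_eq_iff_nonneg)
  show "P (e n) = complex_of_real (s n) *\<^sub>C e n"
  proof (cases "s n = 0")
    case True
    then show ?thesis using nP[of "e n"] by simp
  next
    case False
    \<comment> \<open>\<open>P + s n\<close> is injective since \<open>P\<close> is positive, and it annihilates \<open>(P - s n) (e n)\<close>.\<close>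
    define z where "z = P (e n) - complex_of_real (s n) *\<^sub>C e n"
    have "P z = - (complex_of_real (s n) *\<^sub>C z)"
      by (simp add: z_def bounded_clinearD(3,6)[OF bP] PP eig scaleC_scaleC power2_eq_square
          complex_vector.scale_right_diff_distrib)
    then have "cinner (P z) z = - complex_of_real (s n * (norm z)\<^sup>2)"
      by (simp add: cinner_scaleC_left cinner_self)
    moreover have "cinner (P z) z \<in> \<real>\<^sub>\<ge>\<^sub>0" using P(1) by (simp add: positive_op_def)
    ultimately have "s n * (norm z)\<^sup>2 \<le> 0" by (simp add: complex_nonneg_Reals_iff)
    then have "z = 0" using False by (simp add: mult_le_0_iff)
    then show ?thesis by (simp add: z_def)
  qed
qed

lemma abs_op_eq_pos_root: "abs_op S = pos_root"
  unfolding abs_op_def sqrt_op_def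
proof (rule the_equality)
  fix P assume P: "positive_op P \<and> P \<circ> P = adjoint_op S \<circ> S"
  have "P x - pos_root x = 0" for x
  proof (rule vanishing[where C = 2 and D = "\<lambda>x. P x - pos_root x"])
    show "bounded_clinear (\<lambda>x. P x - pos_root x)"
      using P bounded_clinear_pos_root by (intro bounded_clinear_diff) (auto simp: positive_op_def)
    show "P (e n) - pos_root (e n) = 0" for n
      using P by (simp add: positive_root_eigenvector(2) pos_root_eigenvector)
    show "norm (P v - pos_root v) \<le> 2 * s n * norm v" if "\<And>i. i < n \<Longrightarrow> cinner v (e i) = 0" for n v
    proof -
      have "norm (P v) \<le> s n * norm v"
        using P positive_root_eigenvector(1)[of P v] tail[of n v] that by simp
      moreover have "norm (pos_root v) \<le> s n * norm v" by (rule norm_pos_root_tail[OF that])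
      ultimately show ?thesis using norm_triangle_ineq4[of "P v" "pos_root v"] by simp
    qed
  qed simp
  then show "P = pos_root" by auto
qed (simp add: positive_op_pos_root pos_root_squared)

lemma finite_singular_level: "0 < t \<Longrightarrow> finite {n. s n = t}"
proof -
  assume "0 < t"
  then have "\<forall>\<^sub>F n in sequentially. s n < t" using order_tendstoD(2)[OF singular_tendsto_0] by blast
  then obtain N where N: "\<And>n. N \<le> n \<Longrightarrow> s n < t" by (auto simp: eventually_sequentially)
  have "{n. s n = t} \<subseteq> {..<N}" using N by (force simp: not_le[symmetric])
  then show ?thesis using finite_subset by blast
qed

text \<open>
  Subtract from an eigenvector its projection to the span. The rest \<open>y\<close> is still in the
  eigenspace, but it is orthogonal to all \<open>e n\<close>, where the root vanishes; so \<open>t y = 0\<close>.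
\<close>

lemma eigenspace_abs_op:
  assumes "0 < t"
  shows "eigenspace (abs_op S) (complex_of_real t) = complex_vector.span (e ` {n. s n = t})"
proof
  let ?I = "{n. s n = t}"
  have subspace: "complex_vector.subspace (eigenspace (abs_op S) (complex_of_real t))"
    by (auto simp: complex_vector.subspace_def eigenspace_def abs_op_eq_pos_root
        bounded_clinearD[OF bounded_clinear_pos_root] scaleC_add_right scaleC_scaleC mult.commute)
  show "complex_vector.span (e ` ?I) \<subseteq> eigenspace (abs_op S) (complex_of_real t)"
    by (rule complex_vector.span_minimal[OF _ subspace])
      (auto simp: eigenspace_def abs_op_eq_pos_root pos_root_eigenvector)
  show "eigenspace (abs_op S) (complex_of_real t) \<subseteq> complex_vector.span (e ` ?I)"
  proof
    fix x assume x: "x \<in> eigenspace (abs_op S) (complex_of_real t)"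
    define y where "y = x - ortho_sum e ?I x"
    have in_span: "ortho_sum e ?I x \<in> complex_vector.span (e ` ?I)"
      unfolding ortho_sum_def
      by (intro complex_vector.span_sum complex_vector.span_scale complex_vector.span_base) auto
    have "ortho_sum e ?I x \<in> eigenspace (abs_op S) (complex_of_real t)"
      using in_span \<open>complex_vector.span (e ` ?I) \<subseteq> _\<close> by blast
    then have "y \<in> eigenspace (abs_op S) (complex_of_real t)"
      unfolding y_def using x complex_vector.subspace_diff[OF subspace] by blast
    then have Py: "pos_root y = complex_of_real t *\<^sub>C y" by (simp add: eigenspace_def abs_op_eq_pos_root)
    have orth: "cinner y (e n) = 0" for n
    proof (cases "s n = t")
      case True
      then show ?thesis
        unfolding y_def using ortho_sum_residual(1)[OF ortho finite_singular_level[OF assms]] by simp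
    next
      case False
      have "cinner (pos_root y) (e n) = cinner y (pos_root (e n))"
        by (rule positive_op_self_adjoint[OF positive_op_pos_root])
      then have "complex_of_real t * cinner y (e n) = complex_of_real (s n) * cinner y (e n)"
        by (simp add: Py pos_root_eigenvector cinner_scaleC_left cinner_scaleC_right)
      then show ?thesis using False by simp
    qed
    have "(\<lambda>n. s n * norm y) \<longlonglongrightarrow> 0 * norm y"
      by (intro tendsto_intros singular_tendsto_0)
    then have "norm (pos_root y) \<le> 0 * norm y"
      using norm_pos_root_tail[OF orth] by (intro LIMSEQ_le_const) auto
    then have "y = 0" using assms by (simp add: Py)
    then show "x \<in> complex_vector.span (e ` ?I)" using in_span by (simp add: y_def)
  qed
qed

lemma independent_orthonormal: "finite I \<Longrightarrow> complex_vector.independent (e ` I)"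
proof (rule complex_vector.independent_if_scalars_zero)
  assume fin: "finite I"
  show "finite (e ` I)" using fin by simp
  fix f x assume sum0: "(\<Sum>x\<in>e ` I. f x *\<^sub>C x) = 0" and x: "x \<in> e ` I"
  then obtain k where k: "k \<in> I" "x = e k" by blast
  have "(\<Sum>i\<in>I. f (e i) *\<^sub>C e i) = 0"
    using sum0 by (subst (asm) sum.reindex) (auto intro: inj_on_subset[OF inj_orthonormal[OF ortho]])
  then show "f x = 0" using orthonormal_cinner_sum[OF ortho fin, of "\<lambda>i. f (e i)" k] k by simp
qed

lemma singular_values: "singular_values S s"
  unfolding singular_values_def
proof (intro conjI allI impI)
  fix t :: real assume t: "0 < t"
  show "card {n. s n = t} = complex_vector.dim (eigenspace (abs_op S) (complex_of_real t))"
    unfolding eigenspace_abs_op[OF t]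
      complex_vector.dim_span_eq_card_independent[OF independent_orthonormal[OF finite_singular_level[OF t]]]
    by (rule card_image[OF inj_on_subset[OF inj_orthonormal[OF ortho] subset_UNIV], symmetric])
qed (use decseq_singular finite_singular_level in auto)

end

section \<open>Comparing singular values\<close>

text \<open>
  Uniqueness of the enumeration, one half. If \<open>s n < s' n = t\<close> at the first index where the
  sequences differ, then \<open>s\<close> takes the value \<open>t\<close> only before \<open>n\<close>, where it agrees with \<open>s'\<close>.
  Hence \<open>s'\<close> takes it at least once more, while both multiplicities equal the dimension of the
  same eigenspace.
\<close>

lemma singular_values_le:
  assumes "singular_values S s" "singular_values S s'"
    and eq: "\<And>m. m < n \<Longrightarrow> s m = s' m"
  shows "s' n \<le> s n"
proof (rule ccontr)
  assume "\<not> ?thesis"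
  then have less: "s n < s' n" by simp
  define t where "t = s' n"
  have t: "0 < t" using less assms(1) by (auto simp: t_def singular_values_def intro: le_less_trans)
  have "{m. s m = t} \<subseteq> {m. s' m = t} - {n}"
  proof
    fix m assume "m \<in> {m. s m = t}"
    then have m: "s m = t" by simp
    have "m < n"
    proof (rule ccontr)
      assume "\<not> m < n"
      then have "s m \<le> s n" using assms(1) by (simp add: singular_values_def decseq_def)
      then show False using less m by (simp add: t_def)
    qed
    then show "m \<in> {m. s' m = t} - {n}" using eq m by simp
  qed
  moreover have "finite {m. s' m = t}" using assms(2) t by (simp add: singular_values_def)
  ultimately have "card {m. s m = t} < card {m. s' m = t}"
    by (intro psubset_card_mono) (auto simp: t_def)
  then show False using assms(1,2) t by (simp add: singular_values_def)
qed

lemma singular_values_unique: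
  assumes "singular_values S s" "singular_values S s'"
  shows "s = s'"
proof
  fix n show "s n = s' n"
    by (induction n rule: less_induct)
      (metis assms singular_values_le order_antisym)
qed

text \<open>
  Gaussian elimination: an equation with a nonzero coefficient is solved for that unknown and
  substituted into the others, which leaves one equation and one unknown less.
\<close>

lemma homogeneous_system_nontrivial:
  fixes a :: "'i \<Rightarrow> 'j \<Rightarrow> 'k::field"
  assumes "finite I" "finite J" "card I < card J"
  shows "\<exists>c. (\<exists>j\<in>J. c j \<noteq> 0) \<and> (\<forall>i\<in>I. (\<Sum>j\<in>J. c j * a i j) = 0)"
  using assms
proof (induction I arbitrary: J a rule: finite_induct)
  case empty
  then obtain j where "j \<in> J" by (metis card.empty less_irrefl ex_in_conv)
  then show ?case by (intro exI[of _ "\<lambda>_. 1"]) auto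
next
  case (insert i I)
  show ?case
  proof (cases "\<forall>j\<in>J. a i j = 0")
    case True
    obtain c where "\<exists>j\<in>J. c j \<noteq> 0" "\<forall>i\<in>I. (\<Sum>j\<in>J. c j * a i j) = 0"
      using insert.IH[OF insert.prems(1), of a] insert.prems(2) insert.hyps by auto
    with True show ?thesis by auto
  next
    case False
    then obtain k where k: "k \<in> J" "a i k \<noteq> 0" by blast
    let ?J = "J - {k}"
    have "finite ?J" "card I < card ?J" using insert.prems insert.hyps k(1) by auto
    from insert.IH[OF this, of "\<lambda>l j. a l j - a l k * a i j / a i k"]
    obtain c where c: "\<exists>j\<in>?J. c j \<noteq> 0"
      and sum0: "\<forall>l\<in>I. (\<Sum>j\<in>?J. c j * (a l j - a l k * a i j / a i k)) = 0" by blast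
    define r where "r = - (\<Sum>j\<in>?J. c j * a i j) / a i k"
    define d where "d = c(k := r)"
    have split: "(\<Sum>j\<in>J. d j * a l j) = r * a l k + (\<Sum>j\<in>?J. c j * a l j)" for l
    proof -
      have "(\<Sum>j\<in>?J. d j * a l j) = (\<Sum>j\<in>?J. c j * a l j)"
        by (rule sum.cong) (auto simp: d_def)
      then show ?thesis unfolding sum.remove[OF insert.prems(1) k(1)] by (simp add: d_def)
    qed
    have "(\<Sum>j\<in>J. d j * a l j) = (\<Sum>j\<in>?J. c j * (a l j - a l k * a i j / a i k))" for l
      unfolding split r_def
      by (simp add: right_diff_distrib sum_subtractf sum_distrib_left sum_divide_distrib
          sum_negf[symmetric] ac_simps)
    moreover have "(\<Sum>j\<in>J. d j * a i j) = 0" using k(2) by (simp add: split r_def)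
    moreover have "\<exists>j\<in>J. d j \<noteq> 0" using c by (auto simp: d_def)
    ultimately show ?thesis using sum0 by (intro exI[of _ d]) auto
  qed
qed

text \<open>
  The variational argument. The span of \<open>e 0, \<dots>, e n\<close> has dimension \<open>n + 1\<close>, so it contains some
  \<open>x \<noteq> 0\<close> for which \<open>T x\<close> is orthogonal to \<open>f 0, \<dots>, f (n - 1)\<close>. On this span \<open>S \<circ> T\<close> stretches by
  at least its \<open>n\<close>-th singular value, and on the complement of the \<open>f i\<close> the operator \<open>S\<close>
  stretches by at most its own.
\<close>

lemma singular_system_comp_le:
  assumes "singular_system S f" "singular_system (S \<circ> T) e"
    and T: "bounded_clinear T" and K: "\<And>x. norm (T x) \<le> K * norm x"
  shows "norm (S (T (e n))) \<le> K * norm (S (f n))"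
proof -
  interpret S: singular_system S f by fact
  interpret ST: singular_system "S \<circ> T" e by fact
  obtain c where c: "\<exists>j\<in>{..n}. c j \<noteq> 0"
    "\<forall>i\<in>{..<n}. (\<Sum>j\<in>{..n}. c j * cinner (T (e j)) (f i)) = 0"
    using homogeneous_system_nontrivial[of "{..<n}" "{..n}" "\<lambda>i j. cinner (T (e j)) (f i)"] by auto
  define x where "x = (\<Sum>j\<le>n. c j *\<^sub>C e j)"
  have nx: "(norm x)\<^sup>2 = (\<Sum>j\<le>n. (cmod (c j))\<^sup>2)"
    by (simp add: x_def norm_orthonormal_sum[OF ST.ortho])
  obtain k where "k \<le> n" "c k \<noteq> 0" using c(1) by auto
  then have "0 < (norm x)\<^sup>2" unfolding nx by (intro sum_pos2[of _ k]) auto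
  then have x0: "0 < norm x" by simp
  have "cinner (T x) (f i) = 0" if "i < n" for i
    using c(2) that
    by (simp add: x_def bounded_clinearD(6,8)[OF T] cinner_sum_left cinner_scaleC_left)
  then have upper: "norm (S (T x)) \<le> norm (S (f n)) * norm (T x)" by (rule S.tail)
  have lower: "norm (S (T (e n))) * norm x \<le> norm (S (T x))"
  proof (rule power2_le_imp_le)
    have "ST.pos_root x = (\<Sum>j\<le>n. (c j * complex_of_real (norm (S (T (e j))))) *\<^sub>C e j)"
      by (simp add: x_def bounded_clinearD(6,8)[OF ST.bounded_clinear_pos_root]
          ST.pos_root_eigenvector scaleC_scaleC)
    moreover have "norm (S (T x)) = norm (ST.pos_root x)"
      using ST.positive_root_eigenvector(1)[OF ST.positive_op_pos_root ST.pos_root_squared] by simp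
    ultimately have "(norm (S (T x)))\<^sup>2 = (\<Sum>j\<le>n. (cmod (c j))\<^sup>2 * (norm (S (T (e j))))\<^sup>2)"
      by (simp add: norm_orthonormal_sum[OF ST.ortho] norm_mult power_mult_distrib)
    also have "\<dots> \<ge> (\<Sum>j\<le>n. (cmod (c j))\<^sup>2 * (norm (S (T (e n))))\<^sup>2)"
      using decseqD[OF ST.decseq_singular] by (intro sum_mono mult_left_mono power_mono) auto
    finally show "(norm (S (T (e n))) * norm x)\<^sup>2 \<le> (norm (S (T x)))\<^sup>2"
      by (simp add: power_mult_distrib nx sum_distrib_left mult.commute)
  qed simp
  have "norm (S (T (e n))) * norm x \<le> norm (S (f n)) * (K * norm x)"
    using lower upper mult_left_mono[OF K[of x], of "norm (S (f n))"] by simp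
  then have "norm (S (T (e n))) * norm x \<le> (K * norm (S (f n))) * norm x" by (simp add: ac_simps)
  then show ?thesis using x0 by simp
qed

section \<open>The Schatten class is a right ideal\<close>

lemma compact_op_comp:
  assumes S: "compact_op S" and T: "bounded_clinear T"
  shows "compact_op (S \<circ> T)"
  unfolding compact_op_def
proof
  have bS: "bounded_clinear S" using S by (simp add: compact_op_def)
  then show "bounded_clinear (S \<circ> T)" using T by (rule bounded_clinear_comp)
  obtain K where K: "0 < K" "\<And>x. norm (T x) \<le> K * norm x" using bounded_clinear_bound[OF T] by metis
  let ?C = "(\<lambda>x. K *\<^sub>R x) ` closure (S ` cball 0 1)"
  have cpt: "compact ?C" using S by (intro compact_scaling) (simp add: compact_op_def)
  have "(S \<circ> T) ` cball 0 1 \<subseteq> ?C"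
  proof clarify
    fix x :: 'a assume x: "x \<in> cball 0 1"
    define y where "y = (1 / K) *\<^sub>R T x"
    have "K * norm x \<le> K * 1" using K(1) x by (intro mult_left_mono) auto
    then have "norm (T x) \<le> K" using K(2)[of x] by simp
    then have "y \<in> cball 0 1" using K(1) by (simp add: y_def)
    then have "S y \<in> closure (S ` cball 0 1)"
      using closure_subset[of "S ` cball 0 1"] by (simp add: subset_iff)
    moreover have "(S \<circ> T) x = K *\<^sub>R S y" using K(1) by (simp add: y_def bounded_clinearD(7)[OF bS])
    ultimately show "(S \<circ> T) x \<in> ?C" by (intro image_eqI)
  qed
  then have "closure ((S \<circ> T) ` cball 0 1) \<subseteq> ?C"
    using compact_imp_closed[OF cpt] by (rule closure_minimal)
  then have "?C \<inter> closure ((S \<circ> T) ` cball 0 1) = closure ((S \<circ> T) ` cball 0 1)" by blast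
  then show "compact (closure ((S \<circ> T) ` cball 0 1))"
    using compact_Int_closed[OF cpt closed_closure, of "(S \<circ> T) ` cball 0 1"] by (simp only:)
qed

text \<open>
  The \<open>n\<close>-th singular value of \<open>S \<circ> T\<close> is at most a constant multiple of that of \<open>S\<close>, so
  summability passes from \<open>S\<close> to \<open>S \<circ> T\<close> by comparison.
\<close>

lemma schatten_class_comp:
  fixes S T :: "'a::complex_hilbert_space \<Rightarrow> 'a"
  assumes inf: "\<nexists>F::'a set. finite F \<and> complex_vector.span F = UNIV"
    and "0 \<le> p" and S: "S \<in> schatten_class p" and T: "bounded_clinear T"
  shows "S \<circ> T \<in> schatten_class p"
proof -
  obtain s where cS: "compact_op S" and s: "singular_values S s" "summable (\<lambda>n. s n powr p)"
    using S by (auto simp: schatten_class_def)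
  have cST: "compact_op (S \<circ> T)" using cS T by (rule compact_op_comp)
  obtain f where f: "singular_system S f" using singular_system_exists[OF inf cS] by metis
  obtain e where e: "singular_system (S \<circ> T) e" using singular_system_exists[OF inf cST] by metis
  obtain K where K: "0 < K" "\<And>x. norm (T x) \<le> K * norm x" using bounded_clinear_bound[OF T] by metis
  have "s = (\<lambda>n. norm (S (f n)))"
    using s(1) singular_system.singular_values[OF f] by (rule singular_values_unique)
  then have le: "norm ((S \<circ> T) (e n)) \<le> K * s n" for n
    using singular_system_comp_le[OF f e T K(2)] by simp
  have "summable (\<lambda>n. norm ((S \<circ> T) (e n)) powr p)"
  proof (rule summable_comparison_test')
    show "summable (\<lambda>n. K powr p * s n powr p)" using s(2) by (rule summable_mult)
    show "norm (norm ((S \<circ> T) (e n)) powr p) \<le> K powr p * s n powr p" if "n \<ge> 0" for n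
    proof -
      have "norm ((S \<circ> T) (e n)) powr p \<le> (K * s n) powr p"
        using le \<open>0 \<le> p\<close> by (intro powr_mono2) auto
      also have "\<dots> = K powr p * s n powr p"
        by (rule powr_mult)
      finally show ?thesis by simp
    qed
  qed
  then show ?thesis
    using cST singular_system.singular_values[OF e] unfolding schatten_class_def by blast
qed

section \<open>Operators with closed range\<close>

text \<open>
  The uniform boundedness principle, for the functionals given by the vectors of \<open>E\<close>. By Baire's theorem,
  one of the closed sets \<open>G n\<close>, on which all of them are bounded by \<open>n\<close>, contains a ball.
\<close>

lemma weakly_bounded_imp_bounded:
  fixes E :: "'a::{real_inner, complete_space} set"
  assumes "\<And>y. \<exists>C. \<forall>z\<in>E. \<bar>inner z y\<bar> \<le> C"
  shows "\<exists>C. \<forall>z\<in>E. norm z \<le> C"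
proof -
  define G where "G n = {y. \<forall>z\<in>E. \<bar>inner z y\<bar> \<le> real n}" for n
  have clG: "closed (G n)" for n
  proof -
    have "G n = (\<Inter>z\<in>E. {y. \<bar>inner z y\<bar> \<le> real n})" by (auto simp: G_def)
    then show ?thesis by (auto intro!: closed_INT closed_Collect_le continuous_intros)
  qed
  have "\<exists>n. y \<in> G n" for y
  proof -
    obtain C where C: "\<forall>z\<in>E. \<bar>inner z y\<bar> \<le> C" using assms by blast
    obtain n where "C \<le> real n" using real_arch_simple by blast
    with C have "y \<in> G n" by (auto simp: G_def intro: order_trans)
    then show ?thesis by blast
  qed
  then have "\<Union>(range G) = UNIV" by blast
  moreover have "interior (\<Union>(range G)) = {}" if "\<And>n. interior (G n) = {}"
    using Met_TC.metric_Baire_category_alt[where \<G> = "range G" and ?'a = 'a] clG that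
    by (auto simp: complete_UNIV)
  ultimately obtain n where "interior (G n) \<noteq> {}" by (metis UNIV_not_empty interior_UNIV)
  then obtain y0 r where r: "0 < r" "ball y0 r \<subseteq> G n" by (metis ex_in_conv mem_interior)
  have "norm z \<le> 4 * real n / r" if z: "z \<in> E" for z
  proof (cases "z = 0")
    case False
    define y where "y = y0 + (r / (2 * norm z)) *\<^sub>R z"
    have "y \<in> G n" "y0 \<in> G n" using r False by (auto simp: y_def dist_norm)
    then have "\<bar>inner z y\<bar> \<le> real n" "\<bar>inner z y0\<bar> \<le> real n" using z by (auto simp: G_def)
    moreover have "inner z y = inner z y0 + r / 2 * norm z"
      using False by (simp add: y_def inner_add_right power2_norm_eq_inner[symmetric] power2_eq_square)
    ultimately have "r / 2 * norm z \<le> 2 * real n" by linarith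
    then show ?thesis using r(1) by (simp add: field_simps)
  qed (use r in simp)
  then show ?thesis by blast
qed

lemma subspace_range:
  assumes "bounded_clinear A" shows "complex_vector.subspace (range A)"
  unfolding complex_vector.subspace_def
  using bounded_clinearD(2,5,6)[OF assms, symmetric] by auto

text \<open>
  The set of \<open>z\<close> in the range with \<open>norm (A\<^sup>* z) \<le> 1\<close> is weakly bounded: modulo the orthogonal
  complement of the range, every \<open>y\<close> has the form \<open>A w\<close>, and
  \<open>\<langle>z, A w\<rangle> = \<langle>A\<^sup>* z, w\<rangle>\<close> is at most \<open>norm w\<close> in modulus. Closedness of the range enters
  through the projection onto it.
\<close>

lemma adjoint_bounded_below_on_range:
  fixes A :: "'a::complex_hilbert_space \<Rightarrow> 'a"
  assumes A: "bounded_clinear A" and cl: "closed (range A)"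
  obtains r where "0 < r" "\<And>z. z \<in> range A \<Longrightarrow> r * norm z \<le> norm (adjoint_op A z)"
proof -
  define E where "E = {z \<in> range A. norm (adjoint_op A z) \<le> 1}"
  note adj = cinner_adjoint_op_left[OF A]
  have "\<exists>C. \<forall>z\<in>E. norm z \<le> C"
  proof (rule weakly_bounded_imp_bounded)
    fix y :: 'a
    obtain p where p: "p \<in> range A" "\<And>v. v \<in> range A \<Longrightarrow> cinner (y - p) v = 0"
      using orthogonal_projection_cinner[OF subspace_range[OF A] cl] by metis
    obtain w where w: "p = A w" using p(1) by blast
    have "\<bar>inner z y\<bar> \<le> norm w" if z: "z \<in> E" for z
    proof -
      have "inner z (y - p) = 0"
        using p(2)[of z] z unfolding inner_commute[of z] by (simp add: E_def inner_eq_Re_cinner)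
      then have "inner z y = inner z p" by (simp add: inner_diff_right)
      also have "\<dots> = inner (adjoint_op A z) w" by (simp add: w inner_eq_Re_cinner adj)
      finally have "inner z y = inner (adjoint_op A z) w" .
      then have "\<bar>inner z y\<bar> \<le> norm (adjoint_op A z) * norm w" by (simp add: Cauchy_Schwarz_ineq2)
      also have "\<dots> \<le> 1 * norm w" using z by (intro mult_right_mono) (auto simp: E_def)
      finally show ?thesis by simp
    qed
    then show "\<exists>C. \<forall>z\<in>E. \<bar>inner z y\<bar> \<le> C" by blast
  qed
  then obtain C' where C': "\<And>z. z \<in> E \<Longrightarrow> norm z \<le> C'" by blast
  define C where "C = max C' 1"
  have C: "0 < C" "norm z \<le> C" if "z \<in> E" for z using C'[OF that] by (auto simp: C_def)
  have C0: "0 < C" by (simp add: C_def)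
  have "(1 / C) * norm z \<le> norm (adjoint_op A z)" if z: "z \<in> range A" for z
  proof (cases "adjoint_op A z = 0")
    case True
    obtain w where "z = A w" using z by blast
    then have "cinner z z = cinner (adjoint_op A z) w" by (simp add: adj)
    then show ?thesis using True by (simp add: cinner_self)
  next
    case False
    have "(1 / norm (adjoint_op A z)) *\<^sub>R z \<in> range A"
      using complex_vector.subspace_scale[OF subspace_range[OF A] z] unfolding scaleR_scaleC by blast
    then have "(1 / norm (adjoint_op A z)) *\<^sub>R z \<in> E"
      using False by (simp add: E_def bounded_clinearD(7)[OF adjoint_op(1)[OF A]])
    from C(2)[OF this] show ?thesis using False C0 by (simp add: field_simps)
  qed
  then show ?thesis using C0 that[of "1 / C"] by simp
qed

text \<open>
  The lower bound for the adjoint makes the image \<open>M\<close> of the range under \<open>A\<^sup>*\<close> closed. An \<open>x\<close> orthogonal to the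
  null space then lies in \<open>M\<close>, say \<open>x = A\<^sup>* z\<close>, and \<open>\<langle>x, x\<rangle> = \<langle>z, A x\<rangle>\<close> turns the bound for
  \<open>A\<^sup>*\<close> into one for \<open>A\<close>.
\<close>

lemma bounded_below_on_complement:
  fixes A :: "'a::complex_hilbert_space \<Rightarrow> 'a"
  assumes A: "bounded_clinear A" and cl: "closed (range A)"
  obtains r where "0 < r"
    "\<And>x. (\<And>u. u \<in> null_space A \<Longrightarrow> cinner x u = 0) \<Longrightarrow> r * norm x \<le> norm (A x)"
proof -
  obtain r where r: "0 < r" "\<And>z. z \<in> range A \<Longrightarrow> r * norm z \<le> norm (adjoint_op A z)"
    using adjoint_bounded_below_on_range[OF A cl] by metis
  note bA' = adjoint_op(1)[OF A] and adj = cinner_adjoint_op_left[OF A]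
  define M where "M = adjoint_op A ` range A"
  have sub: "complex_vector.subspace M"
    using subspace_range[OF bounded_clinear_comp[OF bA' A]] by (simp add: M_def image_comp)
  have "subspace (range A)"
    using subspace_range[OF A] by (auto simp: subspace_def complex_vector.subspace_def scaleR_scaleC)
  then have "complete M"
    unfolding M_def using r cl bounded_clinearD(1)[OF bA']
    by (intro complete_isometric_image[of r "range A" "adjoint_op A"]) (auto simp: complete_eq_closed)
  then have clM: "closed M" by (simp add: complete_eq_closed)
  have "r * norm x \<le> norm (A x)" if x: "\<And>u. u \<in> null_space A \<Longrightarrow> cinner x u = 0" for x
  proof -
    obtain p where p: "p \<in> M" "\<And>v. v \<in> M \<Longrightarrow> cinner (x - p) v = 0"
      using orthogonal_projection_cinner[OF sub clM] by metis
    obtain z where z: "z \<in> range A" "p = adjoint_op A z" using p(1) by (auto simp: M_def)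
    have "cinner (A (x - p)) (A (x - p)) = 0"
      unfolding adjoint_op(2)[OF A] by (rule p(2)) (simp add: M_def)
    then have Au: "A (x - p) = 0" by (simp add: cinner_self)
    have "cinner (x - p) (x - p) = 0"
      using x[of "x - p"] Au unfolding cinner_diff(1)[of x p "x - p"]
      by (simp add: null_space_def z(2) adj)
    then have xp: "x = p" by (simp add: cinner_self)
    show ?thesis
    proof (cases "x = 0")
      case False
      have "norm x * norm x = inner z (A x)"
      proof -
        have "cinner x x = cinner z (A x)" using adj[of z x] xp z(2) by simp
        then show ?thesis
          by (metis inner_eq_Re_cinner power2_eq_square power2_norm_eq_inner)
      qed
      also have "\<dots> \<le> norm z * norm (A x)" by (rule norm_cauchy_schwarz)
      finally have "r * (norm x * norm x) \<le> r * (norm z * norm (A x))" using r(1) by simp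
      also have "\<dots> \<le> norm x * norm (A x)"
        using r(2)[OF z(1)] xp z(2) mult_right_mono[of "r * norm z" "norm x" "norm (A x)"]
        by (simp add: mult.assoc)
      finally have "norm x * (r * norm x) \<le> norm x * norm (A x)" by (simp add: ac_simps)
      then show ?thesis using False by simp
    qed simp
  qed
  with r(1) show ?thesis using that by blast
qed

text \<open>
  The operator \<open>G\<close> constructed here is the Moore-Penrose inverse. It sends \<open>y\<close> to the \<open>x\<close> orthogonal to the null
  space for which \<open>A x\<close> is the projection of \<open>y\<close> to the range; this is the relation \<open>R y x\<close>. It is bounded
  because \<open>A\<close> is bounded below on the complement of the null space.
\<close>

lemma bounded_inner_inverse_exists:
  fixes A :: "'a::complex_hilbert_space \<Rightarrow> 'a"
  assumes A: "bounded_clinear A" and cl: "closed (range A)"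
  obtains G where "bounded_clinear G" "\<And>x. A (G (A x)) = A x"
proof -
  obtain r where r: "0 < r"
    "\<And>x. (\<And>u. u \<in> null_space A \<Longrightarrow> cinner x u = 0) \<Longrightarrow> r * norm x \<le> norm (A x)"
    using bounded_below_on_complement[OF A cl] by metis
  define R where "R y x \<longleftrightarrow> (\<forall>u\<in>null_space A. cinner x u = 0) \<and> (\<forall>w. cinner (y - A x) (A w) = 0)"
    for y x
  have bound: "r * norm x \<le> norm y" if "R y x" for y x
  proof -
    have "cinner (y - A x) (A x) = 0" using that unfolding R_def by blast
    from norm_add_orthogonal[OF this]
    have "(norm y)\<^sup>2 = (norm (y - A x))\<^sup>2 + (norm (A x))\<^sup>2" by simp
    then have "(norm (A x))\<^sup>2 \<le> (norm y)\<^sup>2" using zero_le_power2[of "norm (y - A x)"] by linarith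
    then have "norm (A x) \<le> norm y" by (rule power2_le_imp_le) simp
    moreover have "r * norm x \<le> norm (A x)" using that unfolding R_def by (intro r(2)) blast
    ultimately show ?thesis by simp
  qed
  have add: "R (y + y') (x + x')" if "R y x" "R y' x'" for y x y' x'
    using that by (auto simp: R_def bounded_clinearD(2)[OF A] cinner_add_left cinner_diff(1))
  have scale: "R (c *\<^sub>C y) (c *\<^sub>C x)" if "R y x" for c y x
    using that by (auto simp: R_def bounded_clinearD(6)[OF A] cinner_scaleC_left cinner_diff(1))
  have unique: "x = x'" if "R y x" "R y x'" for y x x'
  proof -
    have "R 0 (x - x')" using add[OF that(1) scale[OF that(2), of "-1"]] by simp
    from bound[OF this] show ?thesis using r(1) by (simp add: mult_le_0_iff)
  qed
  have cl_null: "closed (null_space A)"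
    unfolding null_space_def
    by (intro closed_Collect_eq continuous_intros linear_continuous_on bounded_clinearD(1)[OF A])
  have sub_null: "complex_vector.subspace (null_space A)"
    by (auto simp: complex_vector.subspace_def null_space_def bounded_clinearD[OF A])
  have "\<exists>x. R y x" for y
  proof -
    obtain p where p: "p \<in> range A" "\<And>v. v \<in> range A \<Longrightarrow> cinner (y - p) v = 0"
      using orthogonal_projection_cinner[OF subspace_range[OF A] cl] by metis
    obtain w where w: "p = A w" using p(1) by blast
    obtain q where q: "q \<in> null_space A" "\<And>v. v \<in> null_space A \<Longrightarrow> cinner (w - q) v = 0"
      using orthogonal_projection_cinner[OF sub_null cl_null] by metis
    have "A (w - q) = p" using q(1) by (simp add: w bounded_clinearD(3)[OF A] null_space_def)
    then have "R y (w - q)" using p(2) q(2) by (auto simp: R_def)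
    then show ?thesis by blast
  qed
  then obtain G where G: "\<And>y. R y (G y)" by metis
  have "bounded_clinear G"
  proof (rule bounded_clinearI)
    show "G (x + y) = G x + G y" for x y by (rule unique[OF G add[OF G G]])
    show "G (c *\<^sub>C x) = c *\<^sub>C G x" for c x by (rule unique[OF G scale[OF G]])
    show "norm (G y) \<le> norm y * (1 / r)" for y using bound[OF G[of y]] r(1) by (simp add: field_simps)
  qed
  moreover have "A (G (A x)) = A x" for x
  proof -
    have "cinner (A x - A (G (A x))) (A (x - G (A x))) = 0" using G[of "A x"] by (simp add: R_def)
    then show ?thesis by (simp add: bounded_clinearD(3)[OF A] cinner_self)
  qed
  ultimately show ?thesis using that by blast
qed

section \<open>Factorization modulo the Schatten class\<close>

theorem theorem3p8:
  fixes A B :: "'a::complex_hilbert_space \<Rightarrow> 'a" and p :: real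
  assumes "\<nexists>F::'a set. finite F \<and> complex_vector.span F = UNIV"
    and "\<exists>D::'a set. countable D \<and> closure D = UNIV"
    and "1 \<le> p"
    and "bounded_clinear A" and "bounded_clinear B"
    and "closed (range A)"
    and "null_space A \<subseteq> null_space B"
  shows "(\<lambda>x. A x - B x) \<in> schatten_class p \<longleftrightarrow>
    (\<exists>X. bounded_clinear X \<and> (\<lambda>x. X x - x) \<in> schatten_class p \<and> B = X \<circ> A)"
proof
  note A = assms(4) and B = assms(5)
  have p: "0 \<le> p" using assms(3) by simp
  note ideal = schatten_class_comp[OF assms(1) p]
  {
    assume S: "(\<lambda>x. A x - B x) \<in> schatten_class p"
    obtain G where G: "bounded_clinear G" "\<And>x. A (G (A x)) = A x"
      using bounded_inner_inverse_exists[OF A assms(6)] by metis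
    \<comment> \<open>On the range of \<open>A\<close>, where \<open>X\<close> has to send \<open>A x\<close> to \<open>B x\<close>, the second summand corrects the
      identity to this map.\<close>
    define X where "X y = y + (B (G y) - A (G y))" for y
    have bX: "bounded_clinear X"
      unfolding X_def[abs_def]
      using bounded_clinear_comp[OF A G(1)] bounded_clinear_comp[OF B G(1)]
      by (intro bounded_clinear_add bounded_clinear_ident bounded_clinear_diff) (simp_all add: o_def)
    have "(\<lambda>x. X x - x) = (\<lambda>x. A x - B x) \<circ> (\<lambda>x. - G x)"
      by (auto simp: X_def bounded_clinearD(4)[OF A] bounded_clinearD(4)[OF B])
    then have "(\<lambda>x. X x - x) \<in> schatten_class p"
      using ideal[OF S bounded_clinear_minus[OF G(1)]] by simp
    moreover have "B = X \<circ> A"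
    proof
      fix x
      have "x - G (A x) \<in> null_space A"
        using G(2) by (simp add: null_space_def bounded_clinearD(3)[OF A])
      then have "x - G (A x) \<in> null_space B" using assms(7) by blast
      then have "B (G (A x)) = B x" by (simp add: null_space_def bounded_clinearD(3)[OF B])
      then show "B x = (X \<circ> A) x" by (simp add: X_def G(2))
    qed
    ultimately show "\<exists>X. bounded_clinear X \<and> (\<lambda>x. X x - x) \<in> schatten_class p \<and> B = X \<circ> A"
      using bX by blast
  next
    assume "\<exists>X. bounded_clinear X \<and> (\<lambda>x. X x - x) \<in> schatten_class p \<and> B = X \<circ> A"
    then obtain X where X: "bounded_clinear X" "(\<lambda>x. X x - x) \<in> schatten_class p" "B = X \<circ> A" by blast
    have "(\<lambda>x. A x - B x) = (\<lambda>x. X x - x) \<circ> (\<lambda>x. - A x)"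
      by (auto simp: X(3) bounded_clinearD(4)[OF X(1)])
    then show "(\<lambda>x. A x - B x) \<in> schatten_class p"
      using ideal[OF X(2) bounded_clinear_minus[OF A]] by simp
  }
qed

end
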